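(* Consider the control-affine system $\dot{\mathbf x}=\mathbf f(\mathbf x)+\mathbf g(\mathbf x)\mathbf u$ with $\mathbf x\in\mathbb R^n$, $\mathbf u\in\mathbb R^m$, and smooth $\mathbf f:\mathbb R^n\to\mathbb R^n$, $\mathbf g:\mathbb R^n\to\mathbb R^{n\times m}$. Let $\mathbf H:\mathbb R^n\to\mathbb S^p$ be smooth, with associated functions $\boldsymbol\Psi_1,\dots,\boldsymbol\Psi_r$ and sets $\mathcal C_i=\{\mathbf x\in\mathbb R^n : \boldsymbol\Psi_i(\mathbf x)\succeq \mathbf 0\}$, $i\in\{1,\dots,r\}$, as defined in the context. If $\mathbf H$ is an optimal decay high-order matrix control barrier function (OD-HOMCBF) for the system, with $\alpha_r$ the extended class-$\mathcal K^e$ function in the OD-HOMCBF condition, then any continuous feedback controller $\mathbf k:\mathbb R^n\to\mathbb R^m$ and $\theta:\mathbb R^n\to\mathbb R_{\ge0}$ satisfying $$\dot{\boldsymbol\Psi}_r(\mathbf x,\mathbf k(\mathbf x))\succeq-\theta(\mathbf x)\,\boldsymbol\alpha_r(\boldsymbol\Psi_r(\mathbf x))$$ for all $\mathbf x$ in an open neighborhood of $\bigcap_{i=1}^r\mathcal C_i$ renders the intersection $\bigcap_{i=1}^r\mathcal C_i$ forward invariant for the closed-loop system under the state feedback $\mathbf u=\mathbf k(\mathbf x)$. In particular, given a nominal controller $\mathbf x\mapsto\mathbf k_{\rm nom}(\mathbf x)\in\mathbb R^m$, a scalar weight $\rho$ and a scalar parameter $\theta_d$, the controller $\mathbf k(\mathbf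 x)$ given by (the $\mathbf u$-component of) $$\arg\min_{\mathbf u\in\mathbb R^m,\ \omega\in\mathbb R_{\ge0}}\ \|\mathbf u-\mathbf k_{\rm nom}(\mathbf x)\|^2+\rho(\omega-\theta_d)^2\quad\text{s.t.}\quad \dot{\boldsymbol\Psi}_r(\mathbf x,\mathbf u)\succeq-\omega\,\boldsymbol\alpha_r(\boldsymbol\Psi_r(\mathbf x)),\quad \omega\ge\theta_d,$$ is continuous on an open neighborhood of $\bigcap_{i=1}^r\mathcal C_i$, and therefore renders the intersection $\bigcap_{i=1}^r\mathcal C_i$ forward invariant for the closed-loop system.
   Context: $\mathbb S^p$ is the set of real symmetric $p\times p$ matrices; $\succeq$, $\succ$ denote the positive semidefinite / positive definite ordering. $\mathbf g_j$ is the $j$-th column of $\mathbf g$. Matrix Lie derivative: for $\mathbf A:\mathbb R^n\to\mathbb S^p$ and a vector field $\mathbf w$, $\mathbf L_{\mathbf w}\mathbf A(\mathbf x)$ is the matrix with entries $\nabla A_{ij}(\mathbf x)^\top\mathbf w(\mathbf x)$. Extended class-$\mathcal K^e$ function: a continuous, strictly increasing $\alpha:\mathbb R\to\mathbb R$ with $\alpha(0)=0$. The bold $\boldsymbol\alpha:\mathbb S^p\to\mathbb S^p$ is defined spectrally from $\alpha$: $\boldsymbol\alpha(Q\,\mathrm{diag}(\lambda_1,\dots,\lambda_p)Q^\top)=Q\,\mathrm{diag}(\alpha(\lambda_1),\dots,\alpha(\lambda_p))Q^\top$ for $Q$ orthogonal. Recursive functions: with extended class-$\mathcal K^e$ functions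 $\alpha_1,\dots,\alpha_{r-1}$, set $\boldsymbol\Psi_1=\mathbf H$ and $\boldsymbol\Psi_{i+1}(\mathbf x)=\mathbf L_{\mathbf f}\boldsymbol\Psi_i(\mathbf x)+\boldsymbol\alpha_i(\boldsymbol\Psi_i(\mathbf x))$ for $i\in\{1,\dots,r-1\}$. Here $r\in\mathbb N$ is the first level for which there exists $j\in\{1,\dots,m\}$ such that $\mathbf L_{\mathbf g_j}\boldsymbol\Psi_r\not\equiv\mathbf 0$. Notation: $\dot{\boldsymbol\Psi}_r(\mathbf x,\mathbf u)=\mathbf L_{\mathbf f}\boldsymbol\Psi_r(\mathbf x)+\sum_{j=1}^m\mathbf L_{\mathbf g_j}\boldsymbol\Psi_r(\mathbf x)\,u_j$. OD-HOMCBF: $\mathbf H$ is an optimal decay high-order matrix control barrier function for the system if there exists an extended class-$\mathcal K^e$ function $\alpha_r$ such that for each $\mathbf x\in\bigcap_{i=1}^r\mathcal C_i$ there exist $\mathbf u\in\mathbb R^m$ and $\omega\in\mathbb R_{\ge0}$ with $\dot{\boldsymbol\Psi}_r(\mathbf x,\mathbf u)\succ-\omega\,\boldsymbol\alpha_r(\boldsymbol\Psi_r(\mathbf x))$. Forward invariance: a set is forward invariant for the closed-loop system if trajectories starting in the set remain in it for all time $t\ge0$.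
   Formalization: Ψ_1,…,Ψ_r are assumed differentiable so that the Lie derivatives exist; for the optimization-based controller, k_nom is assumed continuous, ρ > 0, and Ψ_r continuously differentiable, since the continuity claim fails without these. *)

theory Defs
  imports "HOL-Analysis.Analysis"
begin

section \<open>Regularity\<close>

text \<open>Functions of class C^k on the whole space: in finite dimension, f is of class C^(k+1)
  iff it is differentiable and all its directional derivatives are of class C^k.\<close>

primrec Ck_fun :: "nat \<Rightarrow> ('a::real_normed_vector \<Rightarrow> 'b::real_normed_vector) \<Rightarrow> bool" where
  "Ck_fun 0 h \<longleftrightarrow> continuous_on UNIV h"
| "Ck_fun (Suc k) h \<longleftrightarrow>
     (\<forall>x. h differentiable (at x)) \<and> (\<forall>v. Ck_fun k (\<lambda>x. frechet_derivative h (at x) v))"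

definition smooth_fun :: "('a::real_normed_vector \<Rightarrow> 'b::real_normed_vector) \<Rightarrow> bool" where
  "smooth_fun h \<longleftrightarrow> (\<forall>k. Ck_fun k h)"

definition class_Ke :: "(real \<Rightarrow> real) \<Rightarrow> bool" where
  "class_Ke a \<longleftrightarrow> continuous_on UNIV a \<and> strict_mono a \<and> a 0 = 0"

section \<open>Symmetric matrices\<close>

definition symmetric_mat :: "real^'p^'p \<Rightarrow> bool" where
  "symmetric_mat A \<longleftrightarrow> transpose A = A"

definition psd :: "real^'p^'p \<Rightarrow> bool" where
  "psd A \<longleftrightarrow> symmetric_mat A \<and> (\<forall>v. 0 \<le> v \<bullet> (A *v v))"

definition pd :: "real^'p^'p \<Rightarrow> bool" where
  "pd A \<longleftrightarrow> symmetric_mat A \<and> (\<forall>v. v \<noteq> 0 \<longrightarrow> 0 < v \<bullet> (A *v v))"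

definition loewner_ge :: "real^'p^'p \<Rightarrow> real^'p^'p \<Rightarrow> bool" (infix "\<succeq>" 50) where
  "A \<succeq> B \<longleftrightarrow> psd (A - B)"

definition loewner_gt :: "real^'p^'p \<Rightarrow> real^'p^'p \<Rightarrow> bool" (infix "\<succ>" 50) where
  "A \<succ> B \<longleftrightarrow> pd (A - B)"

definition diag_mat :: "real^'p \<Rightarrow> real^'p^'p" where
  "diag_mat d = (\<chi> i j. if i = j then d $ i else 0)"

text \<open>Only meaningful for symmetric A; the value does not depend on the chosen orthogonal
  diagonalisation, as the lemma \<open>spectral_map_diag\<close> below shows.\<close>

definition spectral_map :: "(real \<Rightarrow> real) \<Rightarrow> real^'p^'p \<Rightarrow> real^'p^'p" where
  "spectral_map a A =
     (THE B. \<exists>Q d. orthogonal_matrix Q \<and> A = Q ** diag_mat d ** transpose Q \<and>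
                   B = Q ** diag_mat (\<chi> i. a (d $ i)) ** transpose Q)"

lemma diag_mat_mult_right: "(P ** diag_mat d) $ i $ j = P $ i $ j * d $ j"
  by (simp add: matrix_matrix_mult_def diag_mat_def if_distrib cong: if_cong)

lemma diag_mat_mult_left: "(diag_mat d ** P) $ i $ j = d $ i * P $ i $ j"
  by (simp add: matrix_matrix_mult_def diag_mat_def if_distrib if_distribR cong: if_cong)

lemma spectral_unique:
  fixes Q R :: "real^'p^'p"
  assumes Q: "orthogonal_matrix Q" and R: "orthogonal_matrix R"
    and eq: "Q ** diag_mat d ** transpose Q = R ** diag_mat e ** transpose R"
  shows "Q ** diag_mat (\<chi> i. a (d $ i)) ** transpose Q
       = R ** diag_mat (\<chi> i. a (e $ i)) ** transpose R"
proof -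
  define P where "P = transpose R ** Q"
  have Q1: "transpose Q ** Q = mat 1" "Q ** transpose Q = mat 1"
    and R1: "transpose R ** R = mat 1" "R ** transpose R = mat 1"
    using Q R by (auto simp: orthogonal_matrix_def)
  have "P ** diag_mat d = transpose R ** (Q ** diag_mat d ** transpose Q) ** Q"
    by (simp add: P_def Q1 flip: matrix_mul_assoc)
  also have "\<dots> = transpose R ** (R ** diag_mat e ** transpose R) ** Q"
    by (simp only: eq)
  also have "\<dots> = (transpose R ** R) ** diag_mat e ** P"
    by (simp add: P_def matrix_mul_assoc)
  also have "\<dots> = diag_mat e ** P" by (simp add: R1)
  finally have 1: "P ** diag_mat d = diag_mat e ** P" .
  have 2: "P $ i $ j * d $ j = e $ i * P $ i $ j" for i j
    using arg_cong[OF 1, of "\<lambda>M. M $ i $ j"]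
    by (simp add: diag_mat_mult_left diag_mat_mult_right)
  have "P $ i $ j * a (d $ j) = a (e $ i) * P $ i $ j" for i j
    using 2[of i j] by (cases "P $ i $ j = 0") auto
  then have 3: "P ** diag_mat (\<chi> i. a (d $ i)) = diag_mat (\<chi> i. a (e $ i)) ** P"
    by (simp add: vec_eq_iff diag_mat_mult_left diag_mat_mult_right)
  have RP: "R ** P = Q" by (simp add: P_def matrix_mul_assoc R1)
  have PQ: "P ** transpose Q = transpose R"
    by (simp add: P_def Q1 flip: matrix_mul_assoc)
  have "Q ** diag_mat (\<chi> i. a (d $ i)) ** transpose Q
      = R ** (P ** diag_mat (\<chi> i. a (d $ i))) ** transpose Q"
    by (simp add: RP matrix_mul_assoc)
  also have "\<dots> = R ** diag_mat (\<chi> i. a (e $ i)) ** (P ** transpose Q)"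
    unfolding 3 by (simp add: matrix_mul_assoc)
  finally show ?thesis by (simp add: PQ)
qed

lemma spectral_map_diag:
  assumes "orthogonal_matrix Q"
  shows "spectral_map a (Q ** diag_mat d ** transpose Q)
       = Q ** diag_mat (\<chi> i. a (d $ i)) ** transpose Q"
  unfolding spectral_map_def
  using assms by (intro the_equality) (auto intro: spectral_unique)

section \<open>Lie derivatives and the recursively defined functions\<close>

definition gradient :: "('a::real_inner \<Rightarrow> real) \<Rightarrow> 'a \<Rightarrow> 'a" where
  "gradient h x = (THE D. GDERIV h x :> D)"

definition lie_deriv ::
  "(real^'n \<Rightarrow> real^'n) \<Rightarrow> (real^'n \<Rightarrow> real^'p^'p) \<Rightarrow> real^'n \<Rightarrow> real^'p^'p" where
  "lie_deriv w A x = (\<chi> i j. gradient (\<lambda>y. A y $ i $ j) x \<bullet> w x)"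

text \<open>The index starts at 1; the value at index 0 is never used.\<close>

fun Psi ::
  "(real^'n \<Rightarrow> real^'n) \<Rightarrow> (real^'n \<Rightarrow> real^'p^'p) \<Rightarrow> (nat \<Rightarrow> real \<Rightarrow> real) \<Rightarrow>
   nat \<Rightarrow> real^'n \<Rightarrow> real^'p^'p" where
  "Psi f H \<alpha> 0 = H"
| "Psi f H \<alpha> (Suc 0) = H"
| "Psi f H \<alpha> (Suc (Suc i)) =
     (\<lambda>x. lie_deriv f (Psi f H \<alpha> (Suc i)) x
          + spectral_map (\<alpha> (Suc i)) (Psi f H \<alpha> (Suc i) x))"

definition safe_set ::
  "(real^'n \<Rightarrow> real^'n) \<Rightarrow> (real^'n \<Rightarrow> real^'p^'p) \<Rightarrow> (nat \<Rightarrow> real \<Rightarrow> real) \<Rightarrow>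
   nat \<Rightarrow> (real^'n) set" where
  "safe_set f H \<alpha> i = {x. Psi f H \<alpha> i x \<succeq> 0}"

definition first_input_level ::
  "(real^'n \<Rightarrow> real^'n) \<Rightarrow> (real^'n \<Rightarrow> real^'m^'n) \<Rightarrow> (real^'n \<Rightarrow> real^'p^'p) \<Rightarrow>
   (nat \<Rightarrow> real \<Rightarrow> real) \<Rightarrow> nat \<Rightarrow> bool" where
  "first_input_level f g H \<alpha> r \<longleftrightarrow>
     1 \<le> r \<and>
     (\<exists>j x. lie_deriv (\<lambda>y. column j (g y)) (Psi f H \<alpha> r) x \<noteq> 0) \<and>
     (\<forall>i\<in>{1..<r}. \<not> (\<exists>j x. lie_deriv (\<lambda>y. column j (g y)) (Psi f H \<alpha> i) x \<noteq> 0))"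

definition Psi_dot ::
  "(real^'n \<Rightarrow> real^'n) \<Rightarrow> (real^'n \<Rightarrow> real^'m^'n) \<Rightarrow> (real^'n \<Rightarrow> real^'p^'p) \<Rightarrow>
   (nat \<Rightarrow> real \<Rightarrow> real) \<Rightarrow> nat \<Rightarrow> real^'n \<Rightarrow> real^'m \<Rightarrow> real^'p^'p" where
  "Psi_dot f g H \<alpha> r x u =
     lie_deriv f (Psi f H \<alpha> r) x
     + (\<Sum>j\<in>UNIV. (u $ j) *\<^sub>R lie_deriv (\<lambda>y. column j (g y)) (Psi f H \<alpha> r) x)"

text \<open>The function \<open>\<alpha>r\<close> that the notion asks to exist is a parameter here, because the
  conditions imposed on controllers refer to it.\<close>

definition od_homcbf_with ::
  "(real^'n \<Rightarrow> real^'n) \<Rightarrow> (real^'n \<Rightarrow> real^'m^'n) \<Rightarrow> (real^'n \<Rightarrow> real^'p^'p) \<Rightarrow>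
   (nat \<Rightarrow> real \<Rightarrow> real) \<Rightarrow> nat \<Rightarrow> (real \<Rightarrow> real) \<Rightarrow> bool" where
  "od_homcbf_with f g H \<alpha> r \<alpha>r \<longleftrightarrow>
     class_Ke \<alpha>r \<and>
     (\<forall>x\<in>(\<Inter>i\<in>{1..r}. safe_set f H \<alpha> i).
        \<exists>u. \<exists>\<omega>\<ge>0. Psi_dot f g H \<alpha> r x u \<succ> - (\<omega> *\<^sub>R spectral_map \<alpha>r (Psi f H \<alpha> r x)))"

section \<open>Closed-loop system\<close>

text \<open>Solutions need be neither unique nor globally defined, so all solutions are considered,
  on arbitrary time intervals that start at 0.\<close>

definition solution_on ::
  "('a::real_normed_vector \<Rightarrow> 'a) \<Rightarrow> real set \<Rightarrow> (real \<Rightarrow> 'a) \<Rightarrow> bool" where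
  "solution_on F J x \<longleftrightarrow> (\<forall>t\<in>J. (x has_vector_derivative F (x t)) (at t within J))"

definition forward_invariant :: "('a::real_normed_vector \<Rightarrow> 'a) \<Rightarrow> 'a set \<Rightarrow> bool" where
  "forward_invariant F S \<longleftrightarrow>
     (\<forall>J x. is_interval J \<and> 0 \<in> J \<and> J \<subseteq> {0..} \<and> solution_on F J x \<and> x 0 \<in> S
            \<longrightarrow> (\<forall>t\<in>J. x t \<in> S))"

definition closed_loop ::
  "(real^'n \<Rightarrow> real^'n) \<Rightarrow> (real^'n \<Rightarrow> real^'m^'n) \<Rightarrow> (real^'n \<Rightarrow> real^'m) \<Rightarrow>
   real^'n \<Rightarrow> real^'n" where
  "closed_loop f g k x = f x + g x *v k x"

section \<open>Optimisation-based controller\<close>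

definition qp_cost ::
  "(real^'n \<Rightarrow> real^'m) \<Rightarrow> real \<Rightarrow> real \<Rightarrow> real^'n \<Rightarrow> (real^'m) \<times> real \<Rightarrow> real" where
  "qp_cost knom \<rho> \<theta>d x = (\<lambda>(u, \<omega>). (norm (u - knom x))\<^sup>2 + \<rho> * (\<omega> - \<theta>d)\<^sup>2)"

definition qp_feasible ::
  "(real^'n \<Rightarrow> real^'n) \<Rightarrow> (real^'n \<Rightarrow> real^'m^'n) \<Rightarrow> (real^'n \<Rightarrow> real^'p^'p) \<Rightarrow>
   (nat \<Rightarrow> real \<Rightarrow> real) \<Rightarrow> nat \<Rightarrow> (real \<Rightarrow> real) \<Rightarrow> real \<Rightarrow>
   real^'n \<Rightarrow> (real^'m) \<times> real \<Rightarrow> bool" where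
  "qp_feasible f g H \<alpha> r \<alpha>r \<theta>d x = (\<lambda>(u, \<omega>). 0 \<le> \<omega> \<and>
     Psi_dot f g H \<alpha> r x u \<succeq> - (\<omega> *\<^sub>R spectral_map \<alpha>r (Psi f H \<alpha> r x)) \<and> \<theta>d \<le> \<omega>)"

text \<open>Unspecified at states where the program has no minimiser.\<close>

definition qp_controller ::
  "(real^'n \<Rightarrow> real^'n) \<Rightarrow> (real^'n \<Rightarrow> real^'m^'n) \<Rightarrow> (real^'n \<Rightarrow> real^'p^'p) \<Rightarrow>
   (nat \<Rightarrow> real \<Rightarrow> real) \<Rightarrow> nat \<Rightarrow> (real \<Rightarrow> real) \<Rightarrow>
   (real^'n \<Rightarrow> real^'m) \<Rightarrow> real \<Rightarrow> real \<Rightarrow> real^'n \<Rightarrow> real^'m" where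
  "qp_controller f g H \<alpha> r \<alpha>r knom \<rho> \<theta>d x =
     fst (arg_min (qp_cost knom \<rho> \<theta>d x) (qp_feasible f g H \<alpha> r \<alpha>r \<theta>d x))"

end

theory Submission
  imports Defs
begin

text \<open>Along a closed-loop trajectory in the neighbourhood, the matrix \<open>\<Psi>\<^sub>r\<close> satisfies a differential
  inequality that keeps its least eigenvalue from decreasing while it is negative, whatever the
  size of \<open>\<theta> \<ge> 0\<close>; hence \<open>\<Psi>\<^sub>r\<close> stays positive semidefinite. Below level \<open>r\<close> the input does not
  enter, so \<open>\<Psi>\<^sub>i\<close> inherits positivity from \<open>\<Psi>\<^bsub>i+1\<^esub>\<close> by the same comparison, going down
  from \<open>r\<close> to 1. The comparison is pointwise in the state, so it applies as it stands to the
  optimisation-based controller, which may be discontinuous away from the intersection.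

  After rescaling \<open>\<omega>\<close> by \<open>sqrt \<rho>\<close> the program is the metric projection of a point that moves
  continuously with the state onto a closed convex set cut out by a linear matrix inequality. Enlarging
  \<open>\<omega>\<close> turns the barrier condition into Slater's condition on the intersection; Slater's
  condition is open in the state, and it makes the projection continuous.\<close>

section \<open>Symmetric matrices\<close>

lemma bounded_bilinear_matrix_vector_mult:
  "bounded_bilinear ((*v) :: real^'n^'m \<Rightarrow> real^'n \<Rightarrow> real^'m)"
  unfolding bilinear_conv_bounded_bilinear[symmetric]
  by (auto simp: bilinear_def linear_iff algebra_simps scaleR_matrix_vector_assoc)

lemma bounded_bilinear_matrix_matrix_mult:
  "bounded_bilinear ((**) :: real^'n^'m \<Rightarrow> real^'k^'n \<Rightarrow> real^'k^'m)"
proof -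
  have "(A + B) ** C = A ** C + B ** C" for A B :: "real^'n^'m" and C :: "real^'k^'n"
    by (simp add: matrix_matrix_mult_def vec_eq_iff distrib_right sum.distrib)
  then show ?thesis
    unfolding bilinear_conv_bounded_bilinear[symmetric]
    by (simp add: bilinear_def linear_iff matrix_add_ldistrib matrix_scalar_ac scalar_matrix_assoc)
qed

lemma bounded_linear_transpose:
  "bounded_linear (transpose :: real^'n^'m \<Rightarrow> real^'m^'n)"
  unfolding linear_conv_bounded_linear[symmetric]
  by (auto simp: linear_iff transpose_def vec_eq_iff)

lemma bounded_linear_diag_mat: "bounded_linear (diag_mat :: real^'p \<Rightarrow> real^'p^'p)"
  unfolding linear_conv_bounded_linear[symmetric]
  by (auto simp: linear_iff diag_mat_def vec_eq_iff)

lemmas continuous_on_matrix_vector_mult [continuous_intros] =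
  bounded_bilinear.continuous_on[OF bounded_bilinear_matrix_vector_mult]
lemmas continuous_on_matrix_matrix_mult [continuous_intros] =
  bounded_bilinear.continuous_on[OF bounded_bilinear_matrix_matrix_mult]
lemmas continuous_on_transpose [continuous_intros] =
  bounded_linear.continuous_on[OF bounded_linear_transpose]
lemmas continuous_on_diag_mat [continuous_intros] =
  bounded_linear.continuous_on[OF bounded_linear_diag_mat]

section \<open>Algebra of symmetric and semidefinite matrices\<close>

lemma symmetric_mat_inner:
  "symmetric_mat A \<Longrightarrow> v \<bullet> (A *v w) = (A *v v) \<bullet> w"
  unfolding symmetric_mat_def by (metis dot_lmul_matrix transpose_matrix_vector)

lemma symmetric_mat_add: "symmetric_mat A \<Longrightarrow> symmetric_mat B \<Longrightarrow> symmetric_mat (A + B)"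
  by (simp add: symmetric_mat_def transpose_def vec_eq_iff)

lemma symmetric_mat_scaleR: "symmetric_mat A \<Longrightarrow> symmetric_mat (c *\<^sub>R A)"
  by (simp add: symmetric_mat_def transpose_scalar)

lemma symmetric_mat_sum:
  "(\<And>i. i \<in> I \<Longrightarrow> symmetric_mat (A i)) \<Longrightarrow> symmetric_mat (\<Sum>i\<in>I. A i)"
  by (induction I rule: infinite_finite_induct)
    (auto intro: symmetric_mat_add simp: symmetric_mat_def transpose_def vec_eq_iff)

lemma psd_add: "psd A \<Longrightarrow> psd B \<Longrightarrow> psd (A + B)"
  by (simp add: psd_def symmetric_mat_add algebra_simps)

lemma pd_add_psd: "pd A \<Longrightarrow> psd B \<Longrightarrow> pd (A + B)"
  by (simp add: psd_def pd_def symmetric_mat_add algebra_simps add_nonneg_pos add_pos_nonneg)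

lemma psd_scaleR: "0 \<le> c \<Longrightarrow> psd A \<Longrightarrow> psd (c *\<^sub>R A)"
  by (simp add: psd_def symmetric_mat_scaleR scaleR_matrix_vector_assoc[symmetric])

lemma pd_scaleR: "0 < c \<Longrightarrow> pd A \<Longrightarrow> pd (c *\<^sub>R A)"
  by (simp add: pd_def symmetric_mat_scaleR scaleR_matrix_vector_assoc[symmetric])

lemma pd_imp_psd: "pd A \<Longrightarrow> psd A"
  unfolding pd_def psd_def by (metis inner_zero_left order_less_imp_le order_refl)

section \<open>Topology of the semidefinite cone\<close>

lemma closed_symmetric_mat: "closed {A. symmetric_mat A}"
  unfolding symmetric_mat_def by (intro closed_Collect_eq continuous_intros)

lemma closed_psd: "closed {A. psd A}"
  unfolding psd_def
  by (intro closed_Collect_conj closed_Collect_all closed_Collect_le closed_symmetric_mat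
      continuous_intros)

lemma quadratic_form_scaleR:
  fixes A :: "real^'p^'p"
  shows "(c *\<^sub>R v) \<bullet> (A *v (c *\<^sub>R v)) = c\<^sup>2 * (v \<bullet> (A *v v))"
  by (simp add: matrix_vector_mult_scaleR power2_eq_square)

text \<open>On the compact unit sphere the form of \<open>A\<close> attains a positive minimum, and
  a small perturbation of \<open>A\<close> moves the form on unit vectors by less than that. The set
  omits symmetry, which is not an open condition in general.\<close>

lemma open_positive_quadratic_form:
  "open {A :: real^'p^'p. \<forall>v. v \<noteq> 0 \<longrightarrow> 0 < v \<bullet> (A *v v)}"
proof (rule openI, clarify)
  fix A :: "real^'p^'p"
  assume A: "\<forall>v. v \<noteq> 0 \<longrightarrow> 0 < v \<bullet> (A *v v)"
  obtain k where k: "k > 0" "\<And>(M :: real^'p^'p) v. norm (M *v v) \<le> norm M * norm v * k"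
    using bounded_bilinear.pos_bounded[OF bounded_bilinear_matrix_vector_mult] by blast
  have "\<exists>v\<in>sphere 0 1. \<forall>w\<in>sphere 0 1. v \<bullet> (A *v v) \<le> w \<bullet> (A *v w)"
    by (intro continuous_attains_inf continuous_intros) auto
  then obtain v where v: "norm v = 1" "\<And>w. norm w = 1 \<Longrightarrow> v \<bullet> (A *v v) \<le> w \<bullet> (A *v w)"
    by auto
  define m where "m = v \<bullet> (A *v v)"
  have m: "0 < m" using A v(1) unfolding m_def by (metis norm_zero zero_neq_one)
  have pos: "0 < w \<bullet> (B *v w)" if B: "dist A B < m / k" and "w \<noteq> 0" for B w
  proof -
    define u where "u = w /\<^sub>R norm w"
    have u: "norm u = 1" "w = norm w *\<^sub>R u" using \<open>w \<noteq> 0\<close> by (auto simp: u_def)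
    have "\<bar>u \<bullet> ((A - B) *v u)\<bar> \<le> norm u * norm ((A - B) *v u)"
      by (rule Cauchy_Schwarz_ineq2)
    also have "\<dots> \<le> norm (A - B) * k" using k(2)[of "A - B" u] u(1) by simp
    also have "\<dots> < m" using B k(1) by (simp add: dist_norm pos_less_divide_eq)
    finally have "0 < u \<bullet> (B *v u)"
      using v(2)[OF u(1)] by (simp add: m_def algebra_simps inner_diff_right)
    then show ?thesis
      using \<open>w \<noteq> 0\<close> by (subst u(2), subst (2) u(2)) (simp only: quadratic_form_scaleR, simp)
  qed
  show "\<exists>e>0. ball A e \<subseteq> {A. \<forall>v. v \<noteq> 0 \<longrightarrow> 0 < v \<bullet> (A *v v)}"
    using m k(1) pos by (intro exI[of _ "m / k"]) auto
qed

section \<open>Spectral decomposition\<close>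

text \<open>If \<open>b\<close> were nonzero, \<open>t = - b / (c + 1)\<close> would make the
  quadratic negative; the added 1 keeps the denominator positive when \<open>c = 0\<close>.\<close>

lemma linear_coefficient_zero:
  fixes b c :: real
  assumes "0 \<le> c" and "\<And>t. 0 \<le> 2 * t * b + t\<^sup>2 * c"
  shows "b = 0"
proof (rule ccontr)
  assume "b \<noteq> 0"
  define d where "d = c + 1"
  have d: "d > 0" "c = d - 1" using assms(1) by (auto simp: d_def)
  have "0 \<le> (2 * (- b / d) * b + (- b / d)\<^sup>2 * c) * d\<^sup>2"
    using assms(2)[of "- b / d"] by simp
  also have "\<dots> = - (b\<^sup>2 * (d + 1))"
    using d(1) by (simp add: d(2) field_simps power2_eq_square)
  also have "\<dots> < 0" using \<open>b \<noteq> 0\<close> d by simp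
  finally show False by simp
qed

text \<open>First-order optimality: \<open>q\<close> is nonnegative on \<open>S\<close> and vanishes
  at \<open>v\<close>. Along the residual \<open>A *v v - l *\<^sub>R v\<close>, which lies in
  \<open>S\<close> by invariance, its linear coefficient is twice the squared length of the
  residual, so the residual is zero.\<close>

lemma minimiser_is_eigenvector:
  fixes A :: "real^'p^'p"
  assumes A: "symmetric_mat A" and S: "subspace S" and inv: "\<And>w. w \<in> S \<Longrightarrow> A *v w \<in> S"
    and v: "v \<in> S" "norm v = 1"
    and min: "\<And>w. w \<in> S \<Longrightarrow> norm w = 1 \<Longrightarrow> v \<bullet> (A *v v) \<le> w \<bullet> (A *v w)"
  shows "A *v v = (v \<bullet> (A *v v)) *\<^sub>R v"
proof -
  define l where "l = v \<bullet> (A *v v)"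
  define q where "q w = w \<bullet> (A *v w) - l * (w \<bullet> w)" for w
  have q_nonneg: "0 \<le> q w" if "w \<in> S" for w
  proof (cases "w = 0")
    case False
    define u where "u = w /\<^sub>R norm w"
    have u: "norm u = 1" "w = norm w *\<^sub>R u" using False by (auto simp: u_def)
    have "u \<in> S" using S that by (simp add: u_def subspace_scale)
    then have "l \<le> u \<bullet> (A *v u)" using min u(1) by (simp add: l_def)
    then have "(norm w)\<^sup>2 * l \<le> w \<bullet> (A *v w)"
      by (subst u(2), subst (2) u(2)) (simp only: quadratic_form_scaleR, simp add: mult_left_mono)
    then show ?thesis by (simp add: q_def power2_norm_eq_inner mult.commute)
  qed (simp add: q_def)
  define w where "w = A *v v - l *\<^sub>R v"
  have w: "w \<in> S" using S v(1) inv by (simp add: w_def subspace_diff subspace_scale)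
  have qv: "v \<bullet> v = 1" using v(2) by (simp add: norm_eq_1)
  have "q (v + t *\<^sub>R w) = 2 * t * (w \<bullet> w) + t\<^sup>2 * q w" for t
  proof -
    have "w \<bullet> (A *v v) = w \<bullet> w + l * (w \<bullet> v)"
      by (subst (3) w_def) (simp add: inner_diff_right)
    moreover have "v \<bullet> (A *v w) = w \<bullet> (A *v v)"
      using symmetric_mat_inner[OF A, of v w] by (simp add: inner_commute)
    ultimately show ?thesis
      using qv by (simp add: q_def l_def[symmetric] algebra_simps inner_add_left inner_add_right
          matrix_vector_mult_scaleR power2_eq_square inner_commute[of v w])
  qed
  then have "0 \<le> 2 * t * (w \<bullet> w) + t\<^sup>2 * q w" for t
    using q_nonneg[of "v + t *\<^sub>R w"] S v(1) w by (simp add: subspace_add subspace_scale)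
  then have "w \<bullet> w = 0" using linear_coefficient_zero q_nonneg w by blast
  then show ?thesis by (simp add: w_def l_def)
qed

text \<open>A largest orthonormal set of eigenvectors spans the space: otherwise its orthogonal
  complement is nontrivial and invariant under \<open>A\<close>, and a minimiser of the form on the
  unit sphere of that complement is one more eigenvector.\<close>

lemma spectral_theorem:
  fixes A :: "real^'p^'p"
  assumes A: "symmetric_mat A"
  obtains Q d where "orthogonal_matrix Q" "A = Q ** diag_mat d ** transpose Q"
proof -
  define good where "good B \<longleftrightarrow> pairwise orthogonal B \<and> (\<forall>v\<in>B. norm v = 1 \<and> (\<exists>l. A *v v = l *\<^sub>R v))"
    for B :: "(real^'p) set"
  have indep: "independent B" if "good B" for B
    using that unfolding good_def by (intro pairwise_orthogonal_independent) auto
  have bound: "card B \<le> CARD('p)" if "good B" for B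
    using independent_card_le[OF indep[OF that]] by simp
  have "good {}" by (simp add: good_def pairwise_def)
  with bound obtain B where B: "good B" and max: "\<And>B'. good B' \<Longrightarrow> card B' \<le> card B"
    using ex_has_greatest_nat[of good "{}" card "Suc CARD('p)"]
    by (auto simp: less_Suc_eq_le)
  have finB: "finite B" using indep[OF B] independent_imp_finite by blast
  have "span B = UNIV"
  proof (rule ccontr)
    assume "span B \<noteq> UNIV"
    define S where "S = {y. \<forall>x\<in>B. orthogonal x y}"
    have S: "subspace S" unfolding S_def by (rule subspace_orthogonal_to_vectors)
    obtain a where a: "a \<noteq> 0" "\<And>x. x \<in> span B \<Longrightarrow> orthogonal a x"
      using orthogonal_to_subspace_exists_gen[of B UNIV] \<open>span B \<noteq> UNIV\<close> by auto
    then have "a \<in> S" by (auto simp: S_def span_base orthogonal_commute)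
    then have "a /\<^sub>R norm a \<in> S \<inter> sphere 0 1" using S a(1) by (simp add: subspace_scale)
    moreover have "compact (S \<inter> sphere 0 1)"
      using closed_subspace[OF S] by (simp add: closed_Int_compact)
    ultimately have "\<exists>v\<in>S \<inter> sphere 0 1. \<forall>w\<in>S \<inter> sphere 0 1. v \<bullet> (A *v v) \<le> w \<bullet> (A *v w)"
      by (intro continuous_attains_inf continuous_intros) auto
    then obtain v where v: "v \<in> S" "norm v = 1"
      and min: "\<And>w. w \<in> S \<Longrightarrow> norm w = 1 \<Longrightarrow> v \<bullet> (A *v v) \<le> w \<bullet> (A *v w)"
      by auto
    have inv: "A *v w \<in> S" if "w \<in> S" for w
      unfolding S_def
    proof (clarify)
      fix x assume x: "x \<in> B"
      then obtain l where "A *v x = l *\<^sub>R x" using B by (auto simp: good_def)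
      then show "orthogonal x (A *v w)"
        using symmetric_mat_inner[OF A, of x w] x that by (simp add: orthogonal_def S_def)
    qed
    have "\<exists>l. A *v v = l *\<^sub>R v"
      using minimiser_is_eigenvector[OF A S inv v min] by blast
    then have "good (insert v B)"
      using B v
      by (auto simp: good_def pairwise_insert S_def orthogonal_commute)
    moreover have "v \<notin> B" using v by (force simp: S_def orthogonal_self)
    ultimately show False using max[of "insert v B"] finB by simp
  qed
  then have "card B = CARD('p)"
    using indep[OF B] dim_eq_card[of B UNIV] by (metis DIM_cart DIM_real dim_UNIV mult.right_neutral dim_span dim_eq_card_independent)
  \<comment> \<open>The basis has as many elements as the index type \<open>'p\<close>, so its
    members can serve as the columns of \<open>Q\<close>.\<close>
  then obtain h where h: "bij_betw h (UNIV :: 'p set) B"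
    using finite_same_card_bij[OF finite finB] by metis
  have hB: "h i \<in> B" for i using h by (auto simp: bij_betw_def)
  have "\<exists>l. A *v (h i) = l *\<^sub>R h i" for i using B hB by (auto simp: good_def)
  then obtain l where l: "\<And>i. A *v h i = l i *\<^sub>R h i" by metis
  define Q :: "real^'p^'p" where "Q = (\<chi> i j. h j $ i)"
  have col: "column j Q = h j" for j by (simp add: Q_def column_def vec_eq_iff)
  have "orthogonal (h i) (h j)" if "i \<noteq> j" for i j
    using B hB[of i] hB[of j] bij_betw_imp_inj_on[OF h] that
    by (auto simp: good_def pairwise_def dest: injD)
  then have Q: "orthogonal_matrix Q"
    unfolding orthogonal_matrix_orthonormal_columns col
    using B hB by (auto simp: good_def)
  have "A ** Q = Q ** diag_mat (\<chi> i. l i)"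
  proof -
    have "(A ** Q) $ i $ j = (Q ** diag_mat (\<chi> i. l i)) $ i $ j" for i j
    proof -
      have "(A ** Q) $ i $ j = (A *v h j) $ i"
        by (simp add: matrix_matrix_mult_def matrix_vector_mult_def Q_def)
      then show ?thesis by (simp add: l diag_mat_mult_right Q_def)
    qed
    then show ?thesis by (simp add: vec_eq_iff)
  qed
  then have "A = Q ** diag_mat (\<chi> i. l i) ** transpose Q"
    using Q by (metis matrix_mul_assoc matrix_mul_rid orthogonal_matrix_def)
  with Q that show thesis by blast
qed

lemma diag_mat_mult_vector: "(diag_mat d *v v) $ i = d $ i * v $ i"
  by (simp add: diag_mat_def matrix_vector_mult_def if_distrib if_distribR cong: if_cong)

lemma symmetric_mat_conj_diag: "symmetric_mat (Q ** diag_mat d ** transpose Q)"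
proof -
  have "transpose (diag_mat d) = diag_mat d" by (auto simp: diag_mat_def transpose_def vec_eq_iff)
  then show ?thesis by (simp add: symmetric_mat_def matrix_transpose_mul matrix_mul_assoc)
qed

lemma symmetric_mat_spectral_map: "symmetric_mat A \<Longrightarrow> symmetric_mat (spectral_map a A)"
  by (metis spectral_theorem spectral_map_diag symmetric_mat_conj_diag)

text \<open>In the eigencoordinates \<open>w\<close> of \<open>v\<close>, only entries whose
  eigenvalue \<open>d $ i\<close> equals \<open>l\<close> can be nonzero, so the transformed
  diagonal multiplies all of \<open>w\<close> by \<open>a l\<close>.\<close>

lemma spectral_map_eigenvector:
  assumes "symmetric_mat A" and ev: "A *v v = l *\<^sub>R v"
  shows "spectral_map a A *v v = a l *\<^sub>R v"
proof -
  obtain Q d where Q: "orthogonal_matrix Q" and A: "A = Q ** diag_mat d ** transpose Q"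
    using spectral_theorem assms(1) by blast
  have Q1: "transpose Q ** Q = mat 1" "Q ** transpose Q = mat 1"
    using Q by (auto simp: orthogonal_matrix_def)
  define w where "w = transpose Q *v v"
  have v: "v = Q *v w" by (simp add: w_def matrix_vector_mul_assoc Q1 del: transpose_matrix_vector)
  have "diag_mat d *v w = transpose Q *v (A *v v)"
    by (simp add: w_def A matrix_vector_mul_assoc matrix_mul_assoc Q1 del: transpose_matrix_vector)
  also have "\<dots> = l *\<^sub>R w" by (simp add: ev w_def matrix_vector_mult_scaleR del: transpose_matrix_vector)
  finally have "d $ i * w $ i = l * w $ i" for i
    by (metis diag_mat_mult_vector vector_scaleR_component real_scaleR_def)
  then have "d $ i = l \<or> w $ i = 0" for i by auto
  then have "diag_mat (\<chi> i. a (d $ i)) *v w = a l *\<^sub>R w"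
    unfolding vec_eq_iff diag_mat_mult_vector by auto metis
  then have "spectral_map a A *v v = Q *v (a l *\<^sub>R w)"
    unfolding A spectral_map_diag[OF Q] w_def by (simp add: matrix_vector_mul_assoc[symmetric] del: transpose_matrix_vector)
  then show ?thesis by (simp add: v matrix_vector_mult_scaleR)
qed

text \<open>In eigencoordinates the form is a sum of squares weighted by the eigenvalues, and each
  \<open>d $ i\<close> is the value of the form of \<open>A\<close> at a column of \<open>Q\<close>,
  hence nonnegative.\<close>

lemma psd_spectral_map:
  assumes "psd A" and a: "\<And>l. 0 \<le> l \<Longrightarrow> 0 \<le> a l"
  shows "psd (spectral_map a A)"
proof -
  obtain Q d where Q: "orthogonal_matrix Q" and A: "A = Q ** diag_mat d ** transpose Q"
    using spectral_theorem assms(1) by (auto simp: psd_def)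
  have quad: "v \<bullet> ((Q ** diag_mat e ** transpose Q) *v v)
      = (\<Sum>i\<in>UNIV. e $ i * ((transpose Q *v v) $ i)\<^sup>2)" for e v
  proof -
    have "v \<bullet> ((Q ** diag_mat e ** transpose Q) *v v) = v \<bullet> (Q *v (diag_mat e *v (transpose Q *v v)))"
      by (simp add: matrix_vector_mul_assoc matrix_mul_assoc del: transpose_matrix_vector)
    also have "\<dots> = (transpose Q *v v) \<bullet> (diag_mat e *v (transpose Q *v v))"
      by (simp add: dot_lmul_matrix)
    finally show ?thesis
      by (simp add: inner_vec_def diag_mat_mult_vector power2_eq_square mult_ac del: transpose_matrix_vector)
  qed
  have "0 \<le> d $ i" for i
  proof -
    have "transpose Q *v (Q *v axis i 1) = axis i 1"
      using Q by (simp add: matrix_vector_mul_assoc orthogonal_matrix_def del: transpose_matrix_vector)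
    then have "(Q *v axis i 1) \<bullet> (A *v (Q *v axis i 1)) = d $ i"
      by (simp add: A quad axis_def if_distrib if_distribR cong: if_cong del: transpose_matrix_vector)
    then show ?thesis using assms(1) by (metis psd_def)
  qed
  then show ?thesis
    unfolding psd_def A spectral_map_diag[OF Q] quad
    using a by (auto intro!: sum_nonneg symmetric_mat_conj_diag)
qed

text \<open>The rows are unit vectors, which bounds the norm, and the defining equation is a closed
  condition.\<close>

lemma compact_orthogonal_matrix: "compact {Q :: real^'p^'p. orthogonal_matrix Q}"
proof -
  have "norm Q \<le> real CARD('p)" if "orthogonal_matrix Q" for Q :: "real^'p^'p"
  proof -
    have "norm (Q $ i) = 1" for i
      using that by (simp add: orthogonal_matrix_orthonormal_rows row_def)
    then show ?thesis
      using L2_set_le_sum[of UNIV "\<lambda>i. norm (Q $ i)"] by (simp add: norm_vec_def)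
  qed
  moreover have "closed {Q :: real^'p^'p. orthogonal_matrix Q}"
    unfolding orthogonal_matrix by (intro closed_Collect_eq continuous_intros)
  ultimately show ?thesis
    unfolding compact_eq_bounded_closed bounded_iff by blast
qed

text \<open>The orthogonal matrices are compact, so on bounded sets the graph of the spectral map is a
  continuous image of a compact set, hence closed.\<close>

lemma continuous_on_spectral_map:
  assumes a: "continuous_on UNIV a"
  shows "continuous_on {A :: real^'p^'p. symmetric_mat A} (spectral_map a)"
proof -
  obtain k where k: "k > 0" "\<And>(M :: real^'p^'p) v. norm (M *v v) \<le> norm M * norm v * k"
    using bounded_bilinear.pos_bounded[OF bounded_bilinear_matrix_vector_mult] by blast
  \<comment> \<open>Each \<open>d $ i\<close> is an eigenvalue with a column of \<open>Q\<close> as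
    unit eigenvector. Bounded matrices therefore have their diagonals in a fixed ball.\<close>
  have eigenvalues_bound: "norm d \<le> real CARD('p) * (norm A * k)"
    if Q: "orthogonal_matrix Q" and A: "A = Q ** diag_mat d ** transpose Q"
    for A Q :: "real^'p^'p" and d
  proof -
    have "\<bar>d $ i\<bar> \<le> norm A * k" for i
    proof -
      define v where "v = Q *v axis i 1"
      have v: "norm v = 1"
        using Q by (simp add: v_def matrix_vector_mult_basis orthogonal_matrix_orthonormal_columns)
      have "transpose Q *v v = axis i 1"
        using Q by (simp add: v_def matrix_vector_mul_assoc orthogonal_matrix_def
            del: transpose_matrix_vector)
      moreover have "diag_mat d *v axis i 1 = d $ i *\<^sub>R axis i 1"
        by (simp add: vec_eq_iff diag_mat_mult_vector axis_def)
      ultimately have "A *v v = d $ i *\<^sub>R v"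
        by (simp add: A v_def matrix_vector_mult_scaleR flip: matrix_vector_mul_assoc
            del: transpose_matrix_vector)
      then show ?thesis using k(2)[of A v] v by simp
    qed
    then have "(\<Sum>i\<in>UNIV. \<bar>d $ i\<bar>) \<le> (\<Sum>i\<in>(UNIV :: 'p set). norm A * k)"
      by (intro sum_mono)
    then show ?thesis using norm_le_l1_cart[of d] by simp
  qed
  have bounded: "continuous_on {A :: real^'p^'p. symmetric_mat A \<and> norm A \<le> R} (spectral_map a)" for R
  proof -
    define D where "D = {Q :: real^'p^'p. orthogonal_matrix Q} \<times> cball (0 :: real^'p) (real CARD('p) * (R * k))"
    define \<phi> where "\<phi> = (\<lambda>(Q :: real^'p^'p, d). (Q ** diag_mat d ** transpose Q,
      Q ** diag_mat (\<chi> i. a (d $ i)) ** transpose Q))"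
    have comp: "compact D" unfolding D_def by (intro compact_Times compact_orthogonal_matrix compact_cball)
    have "continuous_on D \<phi>"
      unfolding \<phi>_def case_prod_unfold
      by (intro continuous_intros continuous_on_compose2[OF a]) auto
    then have comp\<phi>: "compact (\<phi> ` D)" using comp by (rule compact_continuous_image)
    have in_\<phi>: "(A, spectral_map a A) \<in> \<phi> ` D" if A_sym: "symmetric_mat A" and A_norm: "norm A \<le> R" for A
    proof -
      obtain Q d where Q: "orthogonal_matrix Q" and A: "A = Q ** diag_mat d ** transpose Q"
        using spectral_theorem[OF A_sym] by blast
      have "norm d \<le> real CARD('p) * (R * k)"
        using eigenvalues_bound[OF Q A] A_norm k(1)
        by (meson mult_left_mono mult_right_mono of_nat_0_le_iff less_imp_le order_trans)
      then show ?thesis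
        using Q by (intro image_eqI[of _ _ "(Q, d)"]) (auto simp: \<phi>_def D_def A spectral_map_diag)
    qed
    \<comment> \<open>The set \<open>D\<close> also parametrises matrices of norm above
      \<open>R\<close>, so the image has to be cut down to the ball.\<close>
    have graph: "(\<lambda>A. (A, spectral_map a A)) ` {A. symmetric_mat A \<and> norm A \<le> R}
        = \<phi> ` D \<inter> cball 0 R \<times> UNIV"
      using in_\<phi> by (auto simp: \<phi>_def D_def spectral_map_diag symmetric_mat_conj_diag image_iff)
    have "closed ((\<lambda>A. (A, spectral_map a A)) ` {A :: real^'p^'p. symmetric_mat A \<and> norm A \<le> R})"
      unfolding graph
      by (intro closed_Int closed_Times compact_imp_closed[OF comp\<phi>] closed_cball closed_UNIV)
    \<comment> \<open>The closed graph criterion needs a compact codomain; the second components of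
      the image of \<open>D\<close> provide one.\<close>
    moreover have "spectral_map a \<in> {A :: real^'p^'p. symmetric_mat A \<and> norm A \<le> R} \<rightarrow> snd ` \<phi> ` D"
    proof
      fix A :: "real^'p^'p" assume "A \<in> {A. symmetric_mat A \<and> norm A \<le> R}"
      then have "snd (A, spectral_map a A) \<in> snd ` \<phi> ` D" by (intro imageI in_\<phi>) auto
      then show "spectral_map a A \<in> snd ` \<phi> ` D" by simp
    qed
    moreover have comp_snd: "compact (snd ` \<phi> ` D)"
      by (rule compact_continuous_image[OF continuous_on_snd[OF continuous_on_id] comp\<phi>])
    ultimately show ?thesis by (intro continuous_from_closed_graph[OF comp_snd])
  qed
  show ?thesis
    unfolding continuous_on_eq_continuous_within
  proof
    fix A :: "real^'p^'p" assume "A \<in> {A. symmetric_mat A}"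
    \<comment> \<open>Continuity is local, and \<open>A\<close> is interior to the ball of radius
      \<open>norm A + 1\<close>, where the bounded case applies.\<close>
    moreover have "at A within {A. symmetric_mat A}
        = at A within {B. symmetric_mat B \<and> norm B \<le> norm A + 1}"
      by (rule at_within_nhd[of _ "ball 0 (norm A + 1)"]) auto
    ultimately show "continuous (at A within {A. symmetric_mat A}) (spectral_map a)"
      using bounded[of "norm A + 1"] by (simp add: continuous_on_eq_continuous_within)
  qed
qed

section \<open>Invariance of the positive semidefinite cone\<close>

text \<open>If positivity failed, then for small \<open>\<epsilon> > 0\<close> the minimum of \<open>v \<bullet> M t v + \<epsilon> (t - t0)\<close>
  over times and unit vectors would be negative. A minimising \<open>v\<close> is an eigenvector for a negative
  eigenvalue, where the differential inequality forces the function to be strictly increasing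
  in time.\<close>

lemma psd_differential_inequality:
  fixes M M' :: "real \<Rightarrow> real^'p^'p"
  assumes a: "\<And>l. l < 0 \<Longrightarrow> a l \<le> 0"
    and deriv: "\<And>t. t \<in> {t0..t1} \<Longrightarrow> (M has_vector_derivative M' t) (at t within {t0..t1})"
    and sym: "\<And>t. t \<in> {t0..t1} \<Longrightarrow> symmetric_mat (M t)"
    and c: "\<And>t. t \<in> {t0..t1} \<Longrightarrow> 0 \<le> c t"
    and ineq: "\<And>t. t \<in> {t0..t1} \<Longrightarrow> M' t \<succeq> - (c t *\<^sub>R spectral_map a (M t))"
    and init: "psd (M t0)" and t: "t \<in> {t0..t1}"
  shows "psd (M t)"
proof (rule ccontr)
  assume "\<not> psd (M t)"
  then obtain v where v: "v \<bullet> (M t *v v) < 0" using sym[OF t] by (auto simp: psd_def not_le)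
  define u where "u = v /\<^sub>R norm v"
  have "v \<noteq> 0" using v by auto
  then have u: "norm u = 1" "v = norm v *\<^sub>R u" by (auto simp: u_def)
  have "(norm v)\<^sup>2 * (u \<bullet> (M t *v u)) < 0"
    using v by (metis u(2) quadratic_form_scaleR)
  then have neg: "u \<bullet> (M t *v u) < 0" using \<open>v \<noteq> 0\<close> by (simp add: mult_less_0_iff)
  \<comment> \<open>With this slope the tilt \<open>e * (t - t0)\<close> takes back at most half of
    the negative value at \<open>(t, u)\<close>, so \<open>h\<close> is still negative there. The
    added 1 keeps the denominator positive when \<open>t0 = t1\<close>.\<close>
  define e where "e = - (u \<bullet> (M t *v u)) / (2 * (t1 - t0 + 1))"
  have len: "0 < t1 - t0 + 1" using t by auto
  have e: "0 < e" using neg len by (simp add: e_def field_simps)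
  define h where "h = (\<lambda>(s, w). w \<bullet> (M s *v w) + e * (s - t0))"
  have contM: "continuous_on {t0..t1} M"
    using deriv by (meson continuous_on_eq_continuous_within has_vector_derivative_continuous)
  have "\<exists>z\<in>{t0..t1} \<times> sphere 0 1. \<forall>y\<in>{t0..t1} \<times> sphere 0 1. h z \<le> h y"
    unfolding h_def case_prod_unfold
    using t u(1)
    by (intro continuous_attains_inf continuous_intros compact_Times continuous_on_compose2[OF contM])
      auto
  then obtain s w where s: "s \<in> {t0..t1}" and w: "norm w = 1"
    and min: "\<And>s' w'. s' \<in> {t0..t1} \<Longrightarrow> norm w' = 1 \<Longrightarrow> h (s, w) \<le> h (s', w')"
    by auto
  have "e * (t - t0) \<le> e * (t1 - t0 + 1)" using t e by (intro mult_left_mono) auto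
  also have "\<dots> = - (u \<bullet> (M t *v u)) / 2" using len by (simp add: e_def field_simps)
  finally have "h (t, u) < 0" using neg by (simp add: h_def)
  then have hneg: "h (s, w) < 0" using min[OF t u(1)] by simp
  define l where "l = w \<bullet> (M s *v w)"
  have l: "l < 0" using hneg s e by (simp add: h_def l_def) (smt (verit) mult_nonneg_nonneg)
  \<comment> \<open>The form is nonnegative at \<open>t0\<close>, which \<open>l < 0\<close>
    excludes; hence there are admissible times to the left of \<open>s\<close>.\<close>
  have "t0 < s"
    using s init l by (cases "s = t0") (auto simp: psd_def l_def not_less[symmetric])
  \<comment> \<open>For fixed \<open>s\<close> the tilt is constant, so \<open>w\<close> minimises
    the form of \<open>M s\<close> on the whole unit sphere.\<close>
  have ev: "M s *v w = l *\<^sub>R w"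
    unfolding l_def
    by (rule minimiser_is_eigenvector[OF sym[OF s] subspace_UNIV])
      (use w min[OF s] in \<open>auto simp: h_def\<close>)
  have "w \<bullet> (spectral_map a (M s) *v w) = a l"
    using spectral_map_eigenvector[OF sym[OF s] ev] w by (simp add: norm_eq_1)
  moreover have "0 \<le> w \<bullet> ((M' s + c s *\<^sub>R spectral_map a (M s)) *v w)"
    using ineq[OF s] by (simp add: loewner_ge_def psd_def)
  ultimately have "0 \<le> w \<bullet> (M' s *v w) + c s * a l"
    by (simp add: algebra_simps inner_add_right scaleR_matrix_vector_assoc[symmetric])
  moreover have "c s * a l \<le> 0" using c[OF s] a[OF l] by (simp add: mult_nonneg_nonpos)
  \<comment> \<open>At a negative eigenvalue the differential inequality gives a nonnegative slope;
    the tilt makes it strictly positive.\<close>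
  ultimately have pos: "0 < w \<bullet> (M' s *v w) + e" using e by linarith
  have lin: "bounded_linear (\<lambda>A :: real^'p^'p. w \<bullet> (A *v w))"
    by (intro bounded_linear_compose[OF bounded_linear_inner_right]
        bounded_bilinear.bounded_linear_left[OF bounded_bilinear_matrix_vector_mult])
  have "((\<lambda>q. w \<bullet> (M q *v w)) has_vector_derivative w \<bullet> (M' s *v w)) (at s within {t0..t1})"
    using bounded_linear.has_vector_derivative[OF lin deriv[OF s]] .
  then have "((\<lambda>q. h (q, w)) has_real_derivative w \<bullet> (M' s *v w) + e) (at s within {t0..t1})"
    unfolding h_def has_real_derivative_iff_has_vector_derivative[symmetric]
    by (auto intro!: derivative_eq_intros)
  \<comment> \<open>A slightly earlier time would give a smaller value of \<open>h\<close>. The left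
    side is the one to use, as \<open>s\<close> may be the end point \<open>t1\<close>.\<close>
  then obtain d where d: "d > 0"
    "\<And>q. q > 0 \<Longrightarrow> s - q \<in> {t0..t1} \<Longrightarrow> q < d \<Longrightarrow> h (s - q, w) < h (s, w)"
    using has_real_derivative_pos_inc_left[OF _ pos] by blast
  define q where "q = min (d / 2) (s - t0)"
  have "q > 0" "q < d" "s - q \<in> {t0..t1}" using d(1) \<open>t0 < s\<close> s by (auto simp: q_def)
  then show False using d(2)[of q] min[of "s - q" w] w by fastforce
qed

section \<open>Derivatives along trajectories\<close>

text \<open>Since \<open>gradient\<close> is a definite description, it has to be evaluated: the
  Riesz representative of \<open>h'\<close> qualifies, and uniqueness of derivatives leaves no other
  candidate.\<close>

lemma gradient_inner:
  fixes h :: "'a::euclidean_space \<Rightarrow> real"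
  assumes "(h has_derivative h') (at x)"
  shows "gradient h x \<bullet> w = h' w"
proof -
  interpret bounded_linear h' using assms by (rule has_derivative_bounded_linear)
  define D where "D = (\<Sum>b\<in>Basis. h' b *\<^sub>R b)"
  have inner_D: "w \<bullet> D = h' w" for w
  proof -
    have "h' w = h' (\<Sum>b\<in>Basis. (w \<bullet> b) *\<^sub>R b)" by (simp only: euclidean_representation)
    then show ?thesis by (simp add: D_def sum scaleR inner_sum_right mult.commute)
  qed
  have "gradient h x = D"
    unfolding gradient_def
  proof (rule the_equality)
    show "GDERIV h x :> D" using assms by (simp add: gderiv_def inner_D)
  next
    fix E assume "GDERIV h x :> E"
    then have "(h has_derivative (\<lambda>w. w \<bullet> E)) (at x)" by (simp only: gderiv_def)
    then have eq: "(\<lambda>w. w \<bullet> E) = h'" using assms by (rule has_derivative_unique)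
    have "w \<bullet> E = w \<bullet> D" for w
      using fun_cong[OF eq, of w] by (simp only: inner_D)
    then show "E = D" using vector_eq_ldot by blast
  qed
  then show ?thesis using inner_D[of w] by (simp add: inner_commute)
qed

lemma lie_deriv_eq_frechet_derivative:
  assumes "A differentiable (at x)"
  shows "lie_deriv w A x = frechet_derivative A (at x) (w x)"
proof -
  have "(A has_derivative frechet_derivative A (at x)) (at x)"
    using assms by (simp add: frechet_derivative_works)
  then have der: "((\<lambda>y. A y $ i $ j) has_derivative (\<lambda>v. frechet_derivative A (at x) v $ i $ j)) (at x)"
    for i j
    by (intro bounded_linear.has_derivative[OF bounded_linear_vec_nth])
  show ?thesis by (simp add: lie_deriv_def vec_eq_iff gradient_inner[OF der])
qed

text \<open>The entries at \<open>(i, j)\<close> and \<open>(j, i)\<close> are one and the same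
  function, so their gradients coincide.\<close>

lemma symmetric_mat_lie_deriv:
  assumes "\<And>y. symmetric_mat (A y)"
  shows "symmetric_mat (lie_deriv w A x)"
proof -
  have swap: "(\<lambda>y. A y $ i $ j) = (\<lambda>y. A y $ j $ i)" for i j
    using assms unfolding symmetric_mat_def transpose_def by (metis vec_lambda_beta)
  show ?thesis
    unfolding symmetric_mat_def lie_deriv_def transpose_def vec_eq_iff vec_lambda_beta
  proof (intro allI)
    fix i j show "gradient (\<lambda>y. A y $ j $ i) x \<bullet> w x = gradient (\<lambda>y. A y $ i $ j) x \<bullet> w x"
      by (simp only: swap[of j i])
  qed
qed

lemma symmetric_mat_Psi:
  assumes "\<And>y. symmetric_mat (H y)"
  shows "symmetric_mat (Psi f H \<alpha> i x)"
proof (induction i arbitrary: x)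
  case (Suc i)
  then show ?case
    using assms
    by (cases i) (auto intro: symmetric_mat_add symmetric_mat_lie_deriv symmetric_mat_spectral_map)
qed (simp add: assms)

lemma symmetric_mat_Psi_dot:
  assumes "\<And>y. symmetric_mat (H y)"
  shows "symmetric_mat (Psi_dot f g H \<alpha> r x u)"
  unfolding Psi_dot_def using assms
  by (intro symmetric_mat_add symmetric_mat_sum symmetric_mat_scaleR symmetric_mat_lie_deriv
      symmetric_mat_Psi)

text \<open>The vector \<open>g x *v k x\<close> is a combination of the columns of
  \<open>g x\<close>, so linearity of the derivative merges the Lie derivatives into one along the
  closed-loop field.\<close>

lemma Psi_dot_eq_frechet_derivative:
  assumes "Psi f H \<alpha> r differentiable (at x)"
  shows "Psi_dot f g H \<alpha> r x (k x) = frechet_derivative (Psi f H \<alpha> r) (at x) (closed_loop f g k x)"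
proof -
  interpret linear "frechet_derivative (Psi f H \<alpha> r) (at x)"
    using assms by (rule linear_frechet_derivative)
  show ?thesis
    by (simp add: Psi_dot_def closed_loop_def lie_deriv_eq_frechet_derivative[OF assms]
        matrix_mult_sum scalar_mult_eq_scaleR add sum scale)
qed

lemma Psi_has_vector_derivative:
  assumes "(x has_vector_derivative closed_loop f g k (x t)) (at t within J)"
    and "Psi f H \<alpha> i differentiable (at (x t))"
  shows "((\<lambda>t. Psi f H \<alpha> i (x t)) has_vector_derivative Psi_dot f g H \<alpha> i (x t) (k (x t)))
    (at t within J)"
proof -
  have "(Psi f H \<alpha> i has_derivative frechet_derivative (Psi f H \<alpha> i) (at (x t))) (at (x t) within x ` J)"
    using assms(2) by (simp add: frechet_derivative_works has_derivative_at_withinI)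
  then show ?thesis
    using vector_derivative_diff_chain_within[OF assms(1)]
    by (simp add: Psi_dot_eq_frechet_derivative[OF assms(2)] comp_def)
qed

lemma closed_safe_set:
  assumes "continuous_on UNIV (Psi f H \<alpha> i)"
  shows "closed (safe_set f H \<alpha> i)"
proof -
  have "safe_set f H \<alpha> i = Psi f H \<alpha> i -` {A. psd A}"
    by (auto simp: safe_set_def loewner_ge_def)
  then show ?thesis using closed_vimage[OF closed_psd assms] by (simp only:)
qed

text \<open>If a trajectory is outside \<open>C\<close> at \<open>t1\<close>, closedness of
  \<open>C\<close> yields a last earlier time \<open>s\<close> inside. Just after \<open>s\<close>
  it is still in \<open>N\<close>, where the comparison, applied from level \<open>r\<close> down to
  1, keeps it in \<open>C\<close>: a contradiction.\<close>

lemma forward_invariant_safe_sets: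
  fixes f :: "real^'n \<Rightarrow> real^'n" and g :: "real^'n \<Rightarrow> real^'m^'n" and H :: "real^'n \<Rightarrow> real^'p^'p"
    and \<alpha> :: "nat \<Rightarrow> real \<Rightarrow> real" and r :: nat
  defines "C \<equiv> (\<Inter>i\<in>{1..r}. safe_set f H \<alpha> i)"
  assumes sym: "\<And>x. symmetric_mat (H x)"
    and alpha: "\<And>i. i \<in> {1..<r} \<Longrightarrow> class_Ke (\<alpha> i)"
    and diff: "\<And>i x. i \<in> {1..r} \<Longrightarrow> Psi f H \<alpha> i differentiable (at x)"
    and r: "1 \<le> r"
    and Lg: "\<And>i j x. i \<in> {1..<r} \<Longrightarrow> lie_deriv (\<lambda>y. column j (g y)) (Psi f H \<alpha> i) x = 0"
    and alphar: "class_Ke \<alpha>r"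
    and N: "open N" "C \<subseteq> N"
    and theta: "\<And>x. x \<in> N \<Longrightarrow> 0 \<le> \<theta> x"
    and ineq: "\<And>x. x \<in> N \<Longrightarrow>
      Psi_dot f g H \<alpha> r x (k x) \<succeq> - (\<theta> x *\<^sub>R spectral_map \<alpha>r (Psi f H \<alpha> r x))"
  shows "forward_invariant (closed_loop f g k) (C)"
proof -
  have contPsi: "continuous_on UNIV (Psi f H \<alpha> i)" if "i \<in> {1..r}" for i
    using diff[OF that] by (simp add: continuous_at_imp_continuous_on differentiable_imp_continuous_within)
  have closedC: "closed (C)" unfolding C_def by (intro closed_INT ballI closed_safe_set contPsi)
  have Ke_neg: "a l \<le> 0" if "class_Ke a" "l < 0" for a l
    using that by (metis class_Ke_def less_imp_le strict_mono_less_eq)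
  have "x t1 \<in> C"
    if J: "is_interval J" "0 \<in> J" "J \<subseteq> {0..}" and sol: "solution_on (closed_loop f g k) J x"
      and x0: "x 0 \<in> C" and "t1 \<in> J" for J x t1
  proof (rule ccontr)
    assume t1: "x t1 \<notin> C"
    have sub: "{0..t1} \<subseteq> J"
      using mem_is_interval_1_I[OF J(1,2) \<open>t1 \<in> J\<close>] by auto
    have dx: "(x has_vector_derivative closed_loop f g k (x t)) (at t within S)"
      if "S \<subseteq> {0..t1}" "t \<in> S" for S t
    proof (rule has_vector_derivative_within_subset)
      show "(x has_vector_derivative closed_loop f g k (x t)) (at t within J)"
        using sol that sub by (auto simp: solution_on_def)
    qed (use that sub in auto)
    have contx: "continuous_on {0..t1} x"
      unfolding continuous_on_eq_continuous_within
      by (intro ballI has_vector_derivative_continuous[OF dx]) auto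
    have "0 \<le> t1" using J(3) \<open>t1 \<in> J\<close> by auto
    define E where "E = {0..t1} \<inter> x -` C"
    have "closed E" unfolding E_def using contx closedC by (intro continuous_closed_preimage) auto
    then have "compact E" using compact_Int_closed[of "{0..t1}" E] by (simp add: E_def Int_absorb1)
    moreover have "E \<noteq> {}" using x0 \<open>0 \<le> t1\<close> by (auto simp: E_def)
    ultimately obtain s where s: "s \<in> E" and s_max: "\<And>q. q \<in> E \<Longrightarrow> q \<le> s"
      using compact_attains_sup by metis
    have s01: "s \<in> {0..t1}" "x s \<in> C" "s < t1" using s t1 by (auto simp: E_def less_le)
    then have "x s \<in> N" using N(2) by auto
    have "openin (top_of_set {0..t1}) ({0..t1} \<inter> x -` N)"
      using contx N(1) by (rule continuous_openin_preimage_gen)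
    moreover have "s \<in> {0..t1} \<inter> x -` N" using s01 \<open>x s \<in> N\<close> by auto
    ultimately have "\<exists>e>0. \<forall>q\<in>{0..t1}. dist q s < e \<longrightarrow> q \<in> {0..t1} \<inter> x -` N"
      unfolding openin_euclidean_subtopology_iff by blast
    then obtain e where e: "e > 0" "\<And>q. q \<in> {0..t1} \<Longrightarrow> dist q s < e \<Longrightarrow> x q \<in> N"
      by auto
    define s' where "s' = min (s + e / 2) t1"
    have s': "s < s'" "{s..s'} \<subseteq> {0..t1}" using e(1) s01 by (auto simp: s'_def)
    have inN: "x q \<in> N" if "q \<in> {s..s'}" for q
    proof (rule e(2))
      show "q \<in> {0..t1}" using that s'(2) by blast
      show "dist q s < e" using that e(1) by (auto simp: s'_def dist_real_def)
    qed
    have dPsi: "((\<lambda>t. Psi f H \<alpha> i (x t)) has_vector_derivative Psi_dot f g H \<alpha> i (x t) (k (x t)))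
        (at t within {s..s'})" if "i \<in> {1..r}" "t \<in> {s..s'}" for i t
      by (rule Psi_has_vector_derivative[OF dx[OF s'(2) that(2)] diff[OF that(1)]])
    have psd_s: "psd (Psi f H \<alpha> i (x s))" if "i \<in> {1..r}" for i
      using s01(2) that by (auto simp: C_def safe_set_def loewner_ge_def)
    have "\<forall>q\<in>{s..s'}. psd (Psi f H \<alpha> i (x q))" if "1 \<le> i" "i \<le> r" for i
      using that(2,1)
    proof (induction rule: inc_induct)
      case base
      show ?case
      proof
        fix q assume q: "q \<in> {s..s'}"
        show "psd (Psi f H \<alpha> r (x q))"
          by (rule psd_differential_inequality[where M = "\<lambda>t. Psi f H \<alpha> r (x t)" and t = q,
                OF Ke_neg[OF alphar] dPsi symmetric_mat_Psi[OF sym] theta[OF inN] ineq[OF inN]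
                psd_s q])
            (use r in simp_all)
      qed
    next
      case (step i)
      obtain i' where i': "i = Suc i'" using step.prems by (cases i) auto
      have i: "i \<in> {1..<r}" "i \<in> {1..r}" using step by auto
      have Psi_Suc: "Psi f H \<alpha> (Suc i) y = lie_deriv f (Psi f H \<alpha> i) y + spectral_map (\<alpha> i) (Psi f H \<alpha> i y)"
        for y by (simp add: i')
      have Psi_dot: "Psi_dot f g H \<alpha> i y u = lie_deriv f (Psi f H \<alpha> i) y" for y u
        by (simp add: Psi_dot_def Lg[OF i(1)])
      \<comment> \<open>With constant weight 1, the inequality at level \<open>i\<close> is exactly
        positivity at level \<open>Suc i\<close>, which is the induction hypothesis.\<close>
      have ineq_i: "Psi_dot f g H \<alpha> i (x q) (k (x q)) \<succeq> - (1 *\<^sub>R spectral_map (\<alpha> i) (Psi f H \<alpha> i (x q)))"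
        if "q \<in> {s..s'}" for q
        using step that by (simp add: Psi_dot loewner_ge_def flip: Psi_Suc)
      show ?case
      proof
        fix q assume q: "q \<in> {s..s'}"
        show "psd (Psi f H \<alpha> i (x q))"
          by (rule psd_differential_inequality[where M = "\<lambda>t. Psi f H \<alpha> i (x t)" and t = q,
                OF Ke_neg[OF alpha[OF i(1)]] dPsi[OF i(2)] symmetric_mat_Psi[OF sym] _ ineq_i
                psd_s[OF i(2)] q])
            simp_all
      qed
    qed
    then have "x s' \<in> C" using s'(1) by (auto simp: C_def safe_set_def loewner_ge_def)
    then show False using s_max[of s'] s' by (auto simp: E_def)
  qed
  then show ?thesis unfolding forward_invariant_def by blast
qed

section \<open>Continuity of metric projections and of quadratic programs\<close>

text \<open>The assumption \<open>lower\<close> bounds the limiting distance by the optimal one at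
  \<open>x\<close>, and \<open>upper\<close> places cluster points of the projections in
  \<open>F x\<close>. Uniqueness of the projection then identifies every cluster point.\<close>

lemma continuous_on_closest_point_moving:
  fixes F :: "'x::metric_space \<Rightarrow> 'z::euclidean_space set"
  assumes F: "\<And>x. x \<in> N \<Longrightarrow> closed (F x)" "\<And>x. x \<in> N \<Longrightarrow> convex (F x)" "\<And>x. x \<in> N \<Longrightarrow> F x \<noteq> {}"
    and upper: "\<And>X Z x z. (\<And>n. X n \<in> N) \<Longrightarrow> x \<in> N \<Longrightarrow> X \<longlonglongrightarrow> x \<Longrightarrow> (\<And>n. Z n \<in> F (X n)) \<Longrightarrow> Z \<longlonglongrightarrow> z
      \<Longrightarrow> z \<in> F x"
    and lower: "\<And>x z e. x \<in> N \<Longrightarrow> z \<in> F x \<Longrightarrow> 0 < e \<Longrightarrow>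
      \<exists>z'. dist z' z < e \<and> (\<forall>\<^sub>F y in nhds x. z' \<in> F y)"
    and a: "continuous_on N a"
  shows "continuous_on N (\<lambda>x. closest_point (F x) (a x))"
  unfolding continuous_on_sequentially comp_def
proof (intro allI ballI impI, elim conjE)
  fix X x assume x: "x \<in> N" and XN: "\<forall>n. X n \<in> N" and X: "X \<longlonglongrightarrow> x"
  define Z where "Z n = closest_point (F (X n)) (a (X n))" for n
  define z0 where "z0 = closest_point (F x) (a x)"
  have z0: "z0 \<in> F x" unfolding z0_def using F x by (simp add: closest_point_in_set)
  have ZF: "Z n \<in> F (X n)" for n unfolding Z_def using F XN by (simp add: closest_point_in_set)
  have aX: "(\<lambda>n. a (X n)) \<longlonglongrightarrow> a x"
    using a x XN X by (simp add: continuous_on_sequentially comp_def)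
  \<comment> \<open>A point \<open>z'\<close> close to \<open>z0\<close> stays in the nearby sets
    and competes with \<open>Z n\<close>. Two thirds of \<open>e\<close> pay for exchanging
    \<open>a (X n)\<close> and \<open>a x\<close>, the last for replacing \<open>z0\<close> by
    \<open>z'\<close>.\<close>
  have near: "\<forall>\<^sub>F n in sequentially. dist (a x) (Z n) \<le> dist (a x) z0 + e" if e: "e > 0" for e
  proof -
    obtain z' where z': "dist z' z0 < e / 3" "\<forall>\<^sub>F y in nhds x. z' \<in> F y"
      using lower[OF x z0, of "e / 3"] e by auto
    have "\<forall>\<^sub>F n in sequentially. z' \<in> F (X n)"
      using eventually_compose_filterlim[OF z'(2) X] .
    moreover have "\<forall>\<^sub>F n in sequentially. dist (a (X n)) (a x) < e / 3"
      using tendstoD[OF aX, of "e / 3"] e by simp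
    ultimately show ?thesis
    proof eventually_elim
      case (elim n)
      have "dist (a (X n)) (Z n) \<le> dist (a (X n)) z'"
        unfolding Z_def using F XN elim by (simp add: closest_point_le)
      moreover have "dist (a (X n)) z' \<le> dist (a (X n)) (a x) + dist (a x) z0 + dist z' z0"
        using dist_triangle[of "a (X n)" z' "a x"] dist_triangle[of "a x" z' z0]
        by (simp add: dist_commute)
      moreover have "dist (a x) (Z n) \<le> dist (a (X n)) (a x) + dist (a (X n)) (Z n)"
        by (rule dist_triangle3)
      ultimately show ?case using elim z'(1) by linarith
    qed
  qed
  show "(\<lambda>n. closest_point (F (X n)) (a (X n))) \<longlonglongrightarrow> closest_point (F x) (a x)"
  proof (rule ccontr)
    assume "\<not> ?thesis"
    then have "\<not> (\<forall>e>0. \<forall>\<^sub>F n in sequentially. dist (Z n) z0 < e)"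
      unfolding tendsto_iff Z_def z0_def .
    then obtain e where e: "e > 0" "\<not> (\<forall>\<^sub>F n in sequentially. dist (Z n) z0 < e)" by blast
    obtain s :: "nat \<Rightarrow> nat" where s: "strict_mono s" "\<And>n. \<not> dist (Z (s n)) z0 < e"
      using not_eventually_sequentiallyD[OF e(2)] by blast
    obtain K where K: "\<And>n. n \<ge> K \<Longrightarrow> dist (a x) (Z n) \<le> dist (a x) z0 + 1"
      using near[of 1] by (auto simp: eventually_sequentially)
    \<comment> \<open>Shifted by \<open>K\<close>, the subsequence that stays away from
      \<open>z0\<close> lies in a compact ball and has a cluster point.\<close>
    have "\<forall>n. Z (s (n + K)) \<in> cball (a x) (dist (a x) z0 + 1)"
      using K seq_suble[OF s(1)] by (meson add_leD2 mem_cball order_trans)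
    then obtain l s' where s': "strict_mono s'" "(\<lambda>n. Z (s (s' n + K))) \<longlonglongrightarrow> l"
      unfolding comp_def by (rule seq_compactE[OF compact_imp_seq_compact[OF compact_cball], unfolded comp_def])
    define q where "q n = s (s' n + K)" for n
    have q: "strict_mono q" using s(1) s'(1) by (auto simp: q_def strict_mono_def)
    have Zl: "(\<lambda>n. Z (q n)) \<longlonglongrightarrow> l" using s'(2) by (simp add: q_def)
    have "l \<in> F x"
      by (rule upper[of "X \<circ> q" x "Z \<circ> q"])
        (use XN x ZF Zl LIMSEQ_subseq_LIMSEQ[OF X q] in \<open>simp_all add: comp_def\<close>)
    have "dist (a x) l \<le> dist (a x) z0 + d" if "d > 0" for d
    proof (rule tendsto_upperbound)
      show "(\<lambda>n. dist (a x) (Z (q n))) \<longlonglongrightarrow> dist (a x) l" using Zl by (intro tendsto_intros)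
      show "\<forall>\<^sub>F n in sequentially. dist (a x) (Z (q n)) \<le> dist (a x) z0 + d"
        using eventually_subseq[OF q near[OF that]] .
    qed simp
    then have "dist (a x) l \<le> dist (a x) z0" by (rule field_le_epsilon)
    then have "\<forall>y\<in>F x. dist (a x) l \<le> dist (a x) y"
      using closest_point_exists(2)[OF F(1)[OF x] F(3)[OF x], of "a x"] unfolding z0_def[symmetric]
      by (blast intro: order_trans)
    then have "l = z0"
      unfolding z0_def by (intro closest_point_unique F x \<open>l \<in> F x\<close>)
    have "(\<lambda>n. dist (Z (q n)) z0) \<longlonglongrightarrow> dist l z0" using Zl by (intro tendsto_intros)
    moreover have "\<forall>n\<ge>0. e \<le> dist (Z (q n)) z0"
      using s(2) unfolding q_def not_less by blast
    ultimately have "e \<le> dist l z0" by (blast intro: LIMSEQ_le_const)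
    then show False using e(1) \<open>l = z0\<close> by simp
  qed
qed

text \<open>Feasible points can be pushed towards a Slater point; the pushed points are strictly feasible
  and so remain feasible for nearby states.\<close>

lemma parametric_semidefinite_projection:
  fixes B :: "'x::metric_space \<Rightarrow> 'z::euclidean_space \<Rightarrow> real^'p^'p"
  assumes sym: "\<And>x z. symmetric_mat (B x z)"
    and cont: "continuous_on UNIV (\<lambda>(x, z). B x z)"
    and affine: "\<And>x z w t. B x ((1 - t) *\<^sub>R z + t *\<^sub>R w) = (1 - t) *\<^sub>R B x z + t *\<^sub>R B x w"
    and K: "closed K" "convex K"
  defines "F \<equiv> \<lambda>x. {z \<in> K. psd (B x z)}"
    and "N \<equiv> {x. \<exists>z\<in>K. pd (B x z)}"
  shows "open N"
    and "closed (F x)" and "convex (F x)" and "x \<in> N \<Longrightarrow> F x \<noteq> {}"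
    and "continuous_on N a \<Longrightarrow> continuous_on N (\<lambda>x. closest_point (F x) (a x))"
proof -
  have contx: "continuous_on UNIV (\<lambda>x. B x z)" for z
    using continuous_on_compose2[OF cont continuous_on_Pair[OF continuous_on_id continuous_on_const]
        subset_UNIV] by simp
  have contz: "continuous_on UNIV (B x)" for x
    using continuous_on_compose2[OF cont continuous_on_Pair[OF continuous_on_const continuous_on_id]
        subset_UNIV] by simp
  have open_pd: "open {x. pd (B x z)}" for z
  proof -
    \<comment> \<open>All values of \<open>B\<close> are symmetric, so \<open>pd\<close> reduces to
      the positivity condition, which is open.\<close>
    have "{x. pd (B x z)} = (\<lambda>x. B x z) -` {A. \<forall>v. v \<noteq> 0 \<longrightarrow> 0 < v \<bullet> (A *v v)}"
      using sym by (auto simp: pd_def)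
    then show ?thesis using open_vimage[OF open_positive_quadratic_form contx] by simp
  qed
  have "N = (\<Union>z\<in>K. {x. pd (B x z)})" by (auto simp: N_def)
  then show "open N" using open_pd by auto
  show closedF: "closed (F x)" for x
  proof -
    have "F x = K \<inter> B x -` {A. psd A}" by (auto simp: F_def)
    then show ?thesis using K(1) closed_vimage[OF closed_psd contz] by (simp add: closed_Int)
  qed
  show convexF: "convex (F x)" for x
    unfolding convex_alt F_def
    using K(2) by (auto simp: affine convex_alt intro!: psd_add psd_scaleR)
  show nonempty: "F x \<noteq> {}" if "x \<in> N" for x
    using that pd_imp_psd by (auto simp: F_def N_def)
  show "continuous_on N (\<lambda>x. closest_point (F x) (a x))" if a: "continuous_on N a"
  proof (rule continuous_on_closest_point_moving[OF closedF convexF nonempty _ _ a])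
    fix X Z x z
    assume X: "X \<longlonglongrightarrow> x" and Z: "Z \<longlonglongrightarrow> z" "\<And>n. Z n \<in> F (X n)"
    have "(\<lambda>n. B (X n) (Z n)) \<longlonglongrightarrow> B x z"
      using continuous_on_tendsto_compose[OF cont tendsto_Pair[OF X Z(1)]] by simp
    then have "B x z \<in> {A. psd A}"
      by (rule Lim_in_closed_set[OF closed_psd, rotated -1]) (use Z(2) in \<open>auto simp: F_def\<close>)
    moreover have "z \<in> K"
      using K(1) Z by (auto simp: F_def intro: closed_sequentially)
    ultimately show "z \<in> F x" by (simp add: F_def)
  next
    fix x z and e :: real
    assume "x \<in> N" and z: "z \<in> F x" and e: "0 < e"
    then obtain w where w: "w \<in> K" "pd (B x w)" by (auto simp: N_def)
    \<comment> \<open>A positive weight on the Slater point makes the mixture strictly feasible, and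
      this one keeps the displacement \<open>t * dist z w\<close> below \<open>e\<close>, also when
      \<open>z = w\<close>.\<close>
    define t where "t = e / (e + dist z w)"
    have "0 < e + dist z w" using e zero_le_dist[of z w] by linarith
    then have t: "0 < t" "t \<le> 1" using e by (simp_all add: t_def)
    define z' where "z' = (1 - t) *\<^sub>R z + t *\<^sub>R w"
    have "z' - z = t *\<^sub>R (w - z)" by (simp add: z'_def algebra_simps)
    then have "dist z' z = t * dist z w"
      using t by (simp add: dist_norm norm_minus_commute)
    also have "\<dots> < e" using e by (simp add: t_def field_simps add_pos_nonneg)
    finally have "dist z' z < e" .
    moreover have "z' \<in> K" using K(2) w(1) z t by (simp add: z'_def F_def convex_alt)
    moreover have "pd (B x z')"
      unfolding z'_def affine
      using t w(2) z by (subst add.commute) (auto simp: F_def intro!: pd_add_psd pd_scaleR psd_scaleR)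
    then have "\<forall>\<^sub>F y in nhds x. pd (B y z')"
      using eventually_nhds_in_open[OF open_pd, of x z'] by simp
    then have "\<forall>\<^sub>F y in nhds x. psd (B y z')" by (rule eventually_mono) (rule pd_imp_psd)
    ultimately show "\<exists>z'. dist z' z < e \<and> (\<forall>\<^sub>F y in nhds x. z' \<in> F y)"
      by (auto simp: F_def)
  qed
qed

text \<open>\<open>Ck_fun 1\<close> gives continuity in each fixed direction; a direction that
  varies with \<open>x\<close> is expanded in the basis.\<close>

lemma continuous_on_frechet_derivative_apply:
  fixes h :: "'a::euclidean_space \<Rightarrow> 'b::real_normed_vector"
  assumes h: "Ck_fun 1 h" and w: "continuous_on UNIV w"
  shows "continuous_on UNIV (\<lambda>x. frechet_derivative h (at x) (w x))"
proof -
  have h': "h differentiable (at x)" "continuous_on UNIV (\<lambda>x. frechet_derivative h (at x) v)" for x v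
    using h by auto
  have "frechet_derivative h (at x) (w x)
      = (\<Sum>b\<in>Basis. (w x \<bullet> b) *\<^sub>R frechet_derivative h (at x) b)" for x
  proof -
    interpret linear "frechet_derivative h (at x)"
      using h'(1) by (rule linear_frechet_derivative)
    have "frechet_derivative h (at x) (\<Sum>b\<in>Basis. (w x \<bullet> b) *\<^sub>R b)
        = (\<Sum>b\<in>Basis. (w x \<bullet> b) *\<^sub>R frechet_derivative h (at x) b)"
      by (simp add: sum scale del: euclidean_representation)
    then show ?thesis by (simp only: euclidean_representation)
  qed
  then show ?thesis using h'(2) w by (auto intro!: continuous_intros)
qed

text \<open>The rescaling \<open>?T\<close> is a bijection that turns the cost into the squared
  distance to \<open>(knom x, sqrt \<rho> * \<theta>d)\<close>. The set \<open>F\<close> is the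
  feasible set in the new coordinates, with the two bounds on \<open>\<omega>\<close> merged into
  \<open>max 0 \<theta>d\<close>.\<close>

lemma is_arg_min_qp_iff:
  fixes f :: "real^'n \<Rightarrow> real^'n" and g :: "real^'n \<Rightarrow> real^'m^'n" and H :: "real^'n \<Rightarrow> real^'p^'p"
    and \<alpha> :: "nat \<Rightarrow> real \<Rightarrow> real" and r :: nat and x :: "real^'n" and \<alpha>r :: "real \<Rightarrow> real"
    and \<rho> \<theta>d :: real and knom :: "real^'n \<Rightarrow> real^'m"
  assumes rho: "0 < \<rho>"
  defines "F \<equiv> {z \<in> {z. max 0 \<theta>d \<le> snd z / sqrt \<rho>}.
      psd (Psi_dot f g H \<alpha> r x (fst z) + (snd z / sqrt \<rho>) *\<^sub>R spectral_map \<alpha>r (Psi f H \<alpha> r x))}"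
  assumes F: "closed F" "convex F" "F \<noteq> {}"
  shows "is_arg_min (qp_cost knom \<rho> \<theta>d x) (qp_feasible f g H \<alpha> r \<alpha>r \<theta>d x) (u, \<omega>)
    \<longleftrightarrow> (u, sqrt \<rho> * \<omega>) = closest_point F (knom x, sqrt \<rho> * \<theta>d)"
proof -
  let ?T = "\<lambda>(u, \<omega>). (u, sqrt \<rho> * \<omega>) :: (real^'m) \<times> real"
  let ?a = "(knom x, sqrt \<rho> * \<theta>d)"
  have cost: "qp_cost knom \<rho> \<theta>d x z = (dist ?a (?T z))\<^sup>2" for z
  proof -
    have "(\<theta>d * sqrt \<rho> - \<omega> * sqrt \<rho>)\<^sup>2 = \<rho> * (\<omega> - \<theta>d)\<^sup>2" for \<omega>
    proof -
      have "(\<theta>d * sqrt \<rho> - \<omega> * sqrt \<rho>)\<^sup>2 = (sqrt \<rho>)\<^sup>2 * (\<omega> - \<theta>d)\<^sup>2"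
        by (simp add: power2_eq_square algebra_simps)
      then show ?thesis using rho by simp
    qed
    then show ?thesis
      using rho by (cases z) (simp add: qp_cost_def dist_norm norm_Pair norm_minus_commute mult.commute)
  qed
  have feasible: "qp_feasible f g H \<alpha> r \<alpha>r \<theta>d x z \<longleftrightarrow> ?T z \<in> F" for z
    using rho by (cases z) (auto simp: qp_feasible_def F_def loewner_ge_def)
  have less: "qp_cost knom \<rho> \<theta>d x z < qp_cost knom \<rho> \<theta>d x w \<longleftrightarrow> dist ?a (?T z) < dist ?a (?T w)" for z w
    unfolding cost by (meson linorder_not_less power2_le_imp_le power_mono zero_le_dist)
  have surj: "?T (fst y, snd y / sqrt \<rho>) = y" for y using rho by (cases y) simp
  have "is_arg_min (qp_cost knom \<rho> \<theta>d x) (qp_feasible f g H \<alpha> r \<alpha>r \<theta>d x) z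
      \<longleftrightarrow> ?T z \<in> F \<and> (\<forall>y\<in>F. dist ?a (?T z) \<le> dist ?a y)" for z
    unfolding is_arg_min_def feasible less by (metis linorder_not_less surj)
  also have "?T z \<in> F \<and> (\<forall>y\<in>F. dist ?a (?T z) \<le> dist ?a y) \<longleftrightarrow> ?T z = closest_point F ?a" for z
    using closest_point_unique[OF F(2,1)] closest_point_exists[OF F(1,3)] by metis
  finally show ?thesis by simp
qed

text \<open>The \<open>Ck_fun 1\<close> hypothesis makes the constraint matrix \<open>B\<close>
  jointly continuous, so the projection result applies with \<open>N\<close> the set of states where
  Slater's condition holds; the strict barrier condition puts \<open>C\<close> inside
  \<open>N\<close>.\<close>

lemma qp_controller_properties:
  fixes f :: "real^'n \<Rightarrow> real^'n" and g :: "real^'n \<Rightarrow> real^'m^'n" and H :: "real^'n \<Rightarrow> real^'p^'p"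
    and \<alpha> :: "nat \<Rightarrow> real \<Rightarrow> real" and r :: nat and \<alpha>r :: "real \<Rightarrow> real"
    and \<rho> \<theta>d :: real and knom :: "real^'n \<Rightarrow> real^'m"
  defines "C \<equiv> (\<Inter>i\<in>{1..r}. safe_set f H \<alpha> i)"
  assumes contf: "continuous_on UNIV f" and contg: "continuous_on UNIV g"
    and sym: "\<And>x. symmetric_mat (H x)" and r: "1 \<le> r"
    and homcbf: "od_homcbf_with f g H \<alpha> r \<alpha>r"
    and knom: "continuous_on UNIV knom" and rho: "0 < \<rho>" and C1: "Ck_fun 1 (Psi f H \<alpha> r)"
  obtains N where "open N" "C \<subseteq> N"
    "\<And>x. x \<in> N \<Longrightarrow> \<exists>!z. is_arg_min (qp_cost knom \<rho> \<theta>d x) (qp_feasible f g H \<alpha> r \<alpha>r \<theta>d x) z"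
    "continuous_on N (qp_controller f g H \<alpha> r \<alpha>r knom \<rho> \<theta>d)"
proof -
  let ?A = "\<lambda>x. spectral_map \<alpha>r (Psi f H \<alpha> r x)"
  define B where "B x z = Psi_dot f g H \<alpha> r x (fst z) + (snd z / sqrt \<rho>) *\<^sub>R ?A x" for x and z :: "(real^'m) \<times> real"
  define K where "K = {z :: (real^'m) \<times> real. max 0 \<theta>d \<le> snd z / sqrt \<rho>}"
  define F where "F x = {z \<in> K. psd (B x z)}" for x
  define N where "N = {x. \<exists>z\<in>K. pd (B x z)}"
  define a where "a x = (knom x, sqrt \<rho> * \<theta>d)" for x
  have Ke: "class_Ke \<alpha>r" using homcbf by (simp add: od_homcbf_with_def)
  have diff: "Psi f H \<alpha> r differentiable (at x)" for x using C1 by auto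
  have contPsi: "continuous_on UNIV (Psi f H \<alpha> r)"
    using diff by (simp add: continuous_at_imp_continuous_on differentiable_imp_continuous_within)
  have contA: "continuous_on UNIV ?A"
    using Ke by (intro continuous_on_compose2[OF continuous_on_spectral_map contPsi])
      (auto simp: class_Ke_def symmetric_mat_Psi sym)
  have contL: "continuous_on UNIV (lie_deriv w (Psi f H \<alpha> r))" if "continuous_on UNIV w" for w
    using continuous_on_frechet_derivative_apply[OF C1 that]
    by (simp add: lie_deriv_eq_frechet_derivative[OF diff])
  have "continuous_on UNIV (\<lambda>y. column j (g y))" for j
    unfolding column_def 
    by (intro continuous_on_vec_lambda bounded_linear.continuous_on[OF bounded_linear_vec_nth] contg)
  note contL = contL[OF contf] contL[OF this]
  have symB: "symmetric_mat (B x z)" for x z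
    unfolding B_def using sym
    by (intro symmetric_mat_add symmetric_mat_scaleR symmetric_mat_Psi_dot symmetric_mat_spectral_map
        symmetric_mat_Psi)
  have contB: "continuous_on UNIV (\<lambda>(x, z). B x z)"
    unfolding B_def Psi_dot_def case_prod_unfold
    by (intro continuous_intros continuous_on_compose2[OF contA] continuous_on_compose2[OF contL(1)]
        continuous_on_compose2[OF contL(2)]) (use rho in auto)
  have affB: "B x ((1 - t) *\<^sub>R z + t *\<^sub>R w) = (1 - t) *\<^sub>R B x z + t *\<^sub>R B x w" for x z w t
    by (simp add: B_def Psi_dot_def algebra_simps add_divide_distrib diff_divide_distrib sum.distrib
        scaleR_sum_right sum_subtractf)
  have K: "closed K" "convex K"
  proof -
    have "K = {z. max 0 \<theta>d * sqrt \<rho> \<le> snd z}"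
      using rho by (auto simp: K_def le_divide_eq)
    then have "K = UNIV \<times> {max 0 \<theta>d * sqrt \<rho>..}" by auto
    then show "closed K" "convex K" by (simp_all add: closed_Times convex_Times)
  qed
  note proj = parametric_semidefinite_projection[of B K, OF symB contB affB K, folded N_def F_def]
  have arg_min: "is_arg_min (qp_cost knom \<rho> \<theta>d x) (qp_feasible f g H \<alpha> r \<alpha>r \<theta>d x) (u, \<omega>)
      \<longleftrightarrow> (u, sqrt \<rho> * \<omega>) = closest_point (F x) (a x)" if "x \<in> N" for x u \<omega>
    unfolding a_def F_def K_def B_def
    by (rule is_arg_min_qp_iff[OF rho]) (use proj(2,3) proj(4)[OF that] in \<open>simp_all add: F_def K_def B_def\<close>)
  have arg_min': "is_arg_min (qp_cost knom \<rho> \<theta>d x) (qp_feasible f g H \<alpha> r \<alpha>r \<theta>d x) z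
      \<longleftrightarrow> z = (fst (closest_point (F x) (a x)), snd (closest_point (F x) (a x)) / sqrt \<rho>)"
    if "x \<in> N" for x z
    using arg_min[OF that, of "fst z" "snd z"] rho
    by (cases z; cases "closest_point (F x) (a x)") (auto simp: field_simps)
  have C_N: "C \<subseteq> N"
  proof
    fix x assume x: "x \<in> C"
    then have "\<exists>u. \<exists>\<omega>\<ge>0. Psi_dot f g H \<alpha> r x u \<succ> - (\<omega> *\<^sub>R ?A x)"
      using homcbf unfolding od_homcbf_with_def C_def by blast
    then obtain u \<omega> where u: "pd (Psi_dot f g H \<alpha> r x u + \<omega> *\<^sub>R ?A x)"
      by (auto simp: loewner_gt_def)
    have "psd (Psi f H \<alpha> r x)" using x r by (auto simp: C_def safe_set_def loewner_ge_def)
    then have "psd (?A x)"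
      using Ke by (intro psd_spectral_map) (metis class_Ke_def strict_mono_less_eq)+
    \<comment> \<open>This weight meets both lower bounds. The surplus
      \<open>\<omega>' - \<omega>\<close> adds a semidefinite term, because \<open>Psi\<close> at
      level \<open>r\<close> is semidefinite on \<open>C\<close>, so strictness survives.\<close>
    define \<omega>' where "\<omega>' = max \<omega> (max 0 \<theta>d)"
    have "pd ((Psi_dot f g H \<alpha> r x u + \<omega> *\<^sub>R ?A x) + (\<omega>' - \<omega>) *\<^sub>R ?A x)"
      by (rule pd_add_psd[OF u psd_scaleR[OF _ \<open>psd (?A x)\<close>]]) (simp add: \<omega>'_def)
    then have "pd (B x (u, sqrt \<rho> * \<omega>'))" using rho by (simp add: B_def algebra_simps)
    moreover have "(u, sqrt \<rho> * \<omega>') \<in> K" using rho by (simp add: K_def \<omega>'_def le_max_iff_disj)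
    ultimately show "x \<in> N" by (auto simp: N_def)
  qed
  \<comment> \<open>On \<open>N\<close> the minimiser is unique, so the choice operator inside
    \<open>arg_min\<close> returns it.\<close>
  have "qp_controller f g H \<alpha> r \<alpha>r knom \<rho> \<theta>d x = fst (closest_point (F x) (a x))" if "x \<in> N" for x
    unfolding qp_controller_def arg_min_def arg_min'[OF that] by simp
  moreover have "continuous_on N a"
    unfolding a_def using knom by (auto intro!: continuous_intros intro: continuous_on_subset)
  then have "continuous_on N (\<lambda>x. fst (closest_point (F x) (a x)))"
    by (intro continuous_on_fst proj(5))
  ultimately have "continuous_on N (qp_controller f g H \<alpha> r \<alpha>r knom \<rho> \<theta>d)"
    by (simp cong: continuous_on_cong)
  with proj(1) C_N arg_min' show thesis by (intro that) auto
qed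

text \<open>Class-Ke functions are merely continuous, so smoothness of \<open>f\<close> and
  \<open>H\<close> does not make the higher \<open>Psi\<close> differentiable; hence the explicit
  regularity assumptions.\<close>

theorem theorem3:
  fixes f :: "real^'n \<Rightarrow> real^'n"
    and g :: "real^'n \<Rightarrow> real^'m^'n"
    and H :: "real^'n \<Rightarrow> real^'p^'p"
    and \<alpha> :: "nat \<Rightarrow> real \<Rightarrow> real"
    and \<alpha>r :: "real \<Rightarrow> real"
    and r :: nat
  defines "C \<equiv> (\<Inter>i\<in>{1..r}. safe_set f H \<alpha> i)"
  assumes f_smooth: "smooth_fun f"
    and g_smooth: "smooth_fun g"
    and H_smooth: "smooth_fun H"
    and H_sym: "\<And>x. symmetric_mat (H x)"
    and alpha_Ke: "\<And>i. i \<in> {1..<r} \<Longrightarrow> class_Ke (\<alpha> i)"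
    and Psi_differentiable: "\<And>i x. i \<in> {1..r} \<Longrightarrow> Psi f H \<alpha> i differentiable (at x)"
    and level: "first_input_level f g H \<alpha> r"
    and homcbf: "od_homcbf_with f g H \<alpha> r \<alpha>r"
  shows "(\<forall>k \<theta> N.
            continuous_on UNIV k \<and> (\<forall>x. 0 \<le> \<theta> x) \<and> open N \<and> C \<subseteq> N \<and>
            (\<forall>x\<in>N. Psi_dot f g H \<alpha> r x (k x)
                     \<succeq> - (\<theta> x *\<^sub>R spectral_map \<alpha>r (Psi f H \<alpha> r x)))
            \<longrightarrow> forward_invariant (closed_loop f g k) C) \<and>
         (\<forall>knom \<rho> \<theta>d.
            continuous_on UNIV knom \<and> 0 < \<rho> \<and> Ck_fun 1 (Psi f H \<alpha> r)
            \<longrightarrow> (\<exists>N. open N \<and> C \<subseteq> N \<and>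
                    (\<forall>x\<in>N. \<exists>!z. is_arg_min (qp_cost knom \<rho> \<theta>d x)
                                             (qp_feasible f g H \<alpha> r \<alpha>r \<theta>d x) z) \<and>
                    continuous_on N (qp_controller f g H \<alpha> r \<alpha>r knom \<rho> \<theta>d)) \<and>
                forward_invariant (closed_loop f g (qp_controller f g H \<alpha> r \<alpha>r knom \<rho> \<theta>d)) C)"
proof -
  have r: "1 \<le> r" and Lg: "\<And>i j x. i \<in> {1..<r} \<Longrightarrow> lie_deriv (\<lambda>y. column j (g y)) (Psi f H \<alpha> i) x = 0"
    using level by (auto simp: first_input_level_def)
  have Ke: "class_Ke \<alpha>r" using homcbf by (simp add: od_homcbf_with_def)
  have cont: "continuous_on UNIV f" "continuous_on UNIV g"
    using f_smooth[unfolded smooth_fun_def, rule_format, of 0]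
      g_smooth[unfolded smooth_fun_def, rule_format, of 0] by simp_all
  \<comment> \<open>The sign of \<open>\<theta>\<close> is asked for on \<open>N\<close> only, since
    the optimal weight of the program is controlled only there.\<close>
  have invariant: "forward_invariant (closed_loop f g k) C"
    if "open N" "C \<subseteq> N" "\<And>x. x \<in> N \<Longrightarrow> 0 \<le> \<theta> x"
      "\<And>x. x \<in> N \<Longrightarrow> Psi_dot f g H \<alpha> r x (k x) \<succeq> - (\<theta> x *\<^sub>R spectral_map \<alpha>r (Psi f H \<alpha> r x))"
    for k \<theta> N
    unfolding C_def
    by (rule forward_invariant_safe_sets[OF H_sym alpha_Ke Psi_differentiable r Lg Ke that[unfolded C_def]])
  have qp: "(\<exists>N. open N \<and> C \<subseteq> N \<and>
                (\<forall>x\<in>N. \<exists>!z. is_arg_min (qp_cost knom \<rho> \<theta>d x) (qp_feasible f g H \<alpha> r \<alpha>r \<theta>d x) z) \<and>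
                continuous_on N (qp_controller f g H \<alpha> r \<alpha>r knom \<rho> \<theta>d)) \<and>
            forward_invariant (closed_loop f g (qp_controller f g H \<alpha> r \<alpha>r knom \<rho> \<theta>d)) C"
    if prems: "continuous_on UNIV knom" "0 < \<rho>" "Ck_fun 1 (Psi f H \<alpha> r)" for knom \<rho> \<theta>d
  proof -
    obtain N where N: "open N" "C \<subseteq> N"
      and unique: "\<And>x. x \<in> N \<Longrightarrow> \<exists>!z. is_arg_min (qp_cost knom \<rho> \<theta>d x) (qp_feasible f g H \<alpha> r \<alpha>r \<theta>d x) z"
      and contN: "continuous_on N (qp_controller f g H \<alpha> r \<alpha>r knom \<rho> \<theta>d)"
      by (rule qp_controller_properties[where \<theta>d = \<theta>d, OF cont H_sym r homcbf prems, folded C_def])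
        (rule that)
    define z where "z x = arg_min (qp_cost knom \<rho> \<theta>d x) (qp_feasible f g H \<alpha> r \<alpha>r \<theta>d x)" for x
    have feasible: "qp_feasible f g H \<alpha> r \<alpha>r \<theta>d x (z x)" if "x \<in> N" for x
    proof -
      have "is_arg_min (qp_cost knom \<rho> \<theta>d x) (qp_feasible f g H \<alpha> r \<alpha>r \<theta>d x) (z x)"
        unfolding z_def arg_min_def by (rule someI_ex[OF ex1_implies_ex[OF unique[OF that]]])
      then show ?thesis by (simp add: is_arg_min_def)
    qed
    have "forward_invariant (closed_loop f g (qp_controller f g H \<alpha> r \<alpha>r knom \<rho> \<theta>d)) C"
    \<comment> \<open>The optimal \<open>\<omega>\<close>, that is \<open>snd (z x)\<close>, plays
      the part of \<open>\<theta>\<close>.\<close>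
    proof (rule invariant[OF N])
      fix x assume "x \<in> N"
      then show "0 \<le> snd (z x)"
        "Psi_dot f g H \<alpha> r x (qp_controller f g H \<alpha> r \<alpha>r knom \<rho> \<theta>d x)
          \<succeq> - (snd (z x) *\<^sub>R spectral_map \<alpha>r (Psi f H \<alpha> r x))"
        using feasible by (auto simp: qp_feasible_def qp_controller_def z_def case_prod_unfold)
    qed
    then show ?thesis by (intro conjI exI[of _ N] ballI N unique contN)
  qed
  show ?thesis
  proof (rule conjI; intro allI impI; elim conjE)
    fix k \<theta> N
    assume "open N" "C \<subseteq> N" "\<forall>x. 0 \<le> \<theta> x"
      "\<forall>x\<in>N. Psi_dot f g H \<alpha> r x (k x) \<succeq> - (\<theta> x *\<^sub>R spectral_map \<alpha>r (Psi f H \<alpha> r x))"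
    then show "forward_invariant (closed_loop f g k) C" by (intro invariant[of N \<theta>]) simp_all
  qed (rule qp)
qed

end
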